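(* For every $a>0$ and $\nu_0>0$ there exist constants $\eta_0=\eta_0(a,\nu_0)>0$, $c_0=c_0(\nu_0)>0$ and $n_0=n_0(a,\nu_0)\in\mathbb{N}$ such that the following holds. Let $n>d\ge 1$, let $A\in\mathbb{R}^{n\times d}$, and let $\tilde A=Q_\rho(A)=A+E$ be the entrywise stochastic rounding of $A$ with resolution $\rho$, with normalized minimal column variance $\nu$. If $\nu\ge\nu_0$, $d\le\eta_0 n$, and $n\ge n_0$, then $$\mathbb{P}\left\{\sigma_d(\tilde A)\ge c_0\,\rho\sqrt n\right\}\ \ge\ 1-3n^{-a}.$$
   Context: Stochastic rounding (uniformly dithered quantizer): given $R>0$ with $|A_{ij}|\le R$ for all $i,j$ and an integer bit-budget $B\ge 1$, let $M=2^B$, let $q_1<\dots<q_M$ be evenly spaced points with $q_1=-R$, $q_M=R$, and let $\rho=2R/(M-1)$ be the spacing (resolution). For $x\in[q_k,q_{k+1}]$, $Q_\rho(x)=q_{k+1}$ with probability $(x-q_k)/\rho$ and $Q_\rho(x)=q_k$ otherwise. The matrix $\tilde A$ has entries $\tilde A_{ij}=Q_\rho(A_{ij})$, rounded independently over $(i,j)$, and $E=\tilde A-A$. Thus the entries of $E$ are independent, centered, satisfy $|E_{ij}|\le\rho$, and $\mathrm{Var}(E_{ij})\le\rho^2/4$. The normalized minimal column variance is $\nu=\frac{1}{n\rho^2}\min_{1\le j\le d}\sum_{i=1}^n\mathrm{Var}(E_{ij})$. $\sigma_d(\cdot)$ denotes the $d$-th largest (smallest) singular value of an $n\times d$ matrix.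 *)

theory Defs
  imports
    "HOL-Probability.Probability"
    "HOL-Computational_Algebra.Computational_Algebra"
    "Jordan_Normal_Form.Char_Poly"
begin

definition resolution :: "real \<Rightarrow> nat \<Rightarrow> real" where
  "resolution R B = 2 * R / (2 ^ B - 1)"

definition grid_point :: "real \<Rightarrow> nat \<Rightarrow> nat \<Rightarrow> real" where
  "grid_point R B k = - R + (real k - 1) * resolution R B"

text \<open>Cells and grid points are numbered from \<open>1\<close>: the cells are \<open>1, \<dots>, M - 1\<close> with \<open>M = 2 ^ B\<close>.\<close>

definition in_cell :: "real \<Rightarrow> nat \<Rightarrow> nat \<Rightarrow> real \<Rightarrow> bool" where
  "in_cell R B k x \<longleftrightarrow>
     1 \<le> k \<and> k < 2 ^ B \<and> grid_point R B k \<le> x \<and> x \<le> grid_point R B (k + 1)"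

definition cell_round :: "real \<Rightarrow> nat \<Rightarrow> nat \<Rightarrow> real \<Rightarrow> real pmf" where
  "cell_round R B k x =
     map_pmf (\<lambda>up. if up then grid_point R B (k + 1) else grid_point R B k)
       (bernoulli_pmf ((x - grid_point R B k) / resolution R B))"

text \<open>An interior grid point lies in two cells; \<open>stoch_round_eq\<close> below shows that the choice
  of the cell does not matter. Outside \<open>{-R..R}\<close> the value is unspecified.\<close>

definition stoch_round :: "real \<Rightarrow> nat \<Rightarrow> real \<Rightarrow> real pmf" where
  "stoch_round R B x = cell_round R B (SOME k. in_cell R B k x) x"

text \<open>The law of the entrywise rounding of \<open>A\<close>: the entries are independent, and \<open>0\<close> is only the
  dummy value of \<^const>\<open>Pi_pmf\<close> outside the index set.\<close>

definition stoch_round_mat :: "real \<Rightarrow> nat \<Rightarrow> real mat \<Rightarrow> real mat pmf" where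
  "stoch_round_mat R B A =
     map_pmf (Matrix.mat (dim_row A) (dim_col A))
       (Pi_pmf ({..<dim_row A} \<times> {..<dim_col A}) 0 (\<lambda>ij. stoch_round R B (A $$ ij)))"

definition error_variance :: "real \<Rightarrow> nat \<Rightarrow> real mat \<Rightarrow> nat \<Rightarrow> nat \<Rightarrow> real" where
  "error_variance R B A i j =
     measure_pmf.variance (stoch_round_mat R B A) (\<lambda>X. (X - A) $$ (i, j))"

definition normalized_min_col_variance :: "real \<Rightarrow> nat \<Rightarrow> real mat \<Rightarrow> real" where
  "normalized_min_col_variance R B A =
     1 / (real (dim_row A) * (resolution R B)\<^sup>2) *
     Min ((\<lambda>j. \<Sum>i<dim_row A. error_variance R B A i j) ` {..<dim_col A})"

text \<open>The square roots of the eigenvalues of \<open>A\<^sup>T A\<close>, with algebraic multiplicity, in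
  decreasing order. This list has length \<open>dim_col A\<close>, so for a tall matrix it consists exactly of
  the singular values, while for a wide one it has additional trailing zeros.\<close>

definition singular_values :: "real mat \<Rightarrow> real list" where
  "singular_values A =
     rev (sorted_list_of_multiset
       (image_mset sqrt (proots (char_poly (transpose_mat A * A)))))"

definition singular_value :: "nat \<Rightarrow> real mat \<Rightarrow> real" where
  "singular_value k A = singular_values A ! (k - 1)"

lemma resolution_pos: "R > 0 \<Longrightarrow> B \<ge> 1 \<Longrightarrow> resolution R B > 0"
  by (simp add: resolution_def)

lemma grid_point_first: "grid_point R B 1 = - R"
  by (simp add: grid_point_def)

lemma grid_point_last: "B \<ge> 1 \<Longrightarrow> grid_point R B (2 ^ B) = R"
proof -
  assume "B \<ge> 1"
  then have "(1::real) < 2 ^ B" by (intro one_less_power) auto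
  then show ?thesis by (simp add: grid_point_def resolution_def)
qed

lemma grid_point_Suc: "grid_point R B (k + 1) = grid_point R B k + resolution R B"
  by (simp add: grid_point_def algebra_simps)

lemma ex_cell:
  assumes "R > 0" "B \<ge> 1" "\<bar>x\<bar> \<le> R"
  shows "\<exists>k. in_cell R B k x"
proof -
  define k where "k = (LEAST k. x \<le> grid_point R B (k + 1) \<and> 1 \<le> k)"
  have two: "(2::nat) \<le> 2 ^ B" using assms(2) self_le_power[of "2::nat" B] by simp
  have W: "x \<le> grid_point R B ((2 ^ B - 1) + 1) \<and> 1 \<le> (2 ^ B - 1 :: nat)"
  proof
    have "(2 ^ B - 1 :: nat) + 1 = 2 ^ B" using two by linarith
    then show "x \<le> grid_point R B ((2 ^ B - 1) + 1)"
      using assms grid_point_last[of B R] by simp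
    show "1 \<le> (2 ^ B - 1 :: nat)" using two by linarith
  qed
  have k: "x \<le> grid_point R B (k + 1)" "1 \<le> k"
    using LeastI[of "\<lambda>k. x \<le> grid_point R B (k + 1) \<and> 1 \<le> k", OF W] by (auto simp: k_def)
  have "k \<le> 2 ^ B - 1" unfolding k_def 
    by (rule Least_le[of "\<lambda>k. x \<le> grid_point R B (k + 1) \<and> 1 \<le> k", OF W])
  then have "k < 2 ^ B" using two by linarith
  moreover have "grid_point R B k \<le> x"
  proof (cases "k = 1")
    case True
    then show ?thesis using assms(3) by (simp add: grid_point_def)
  next
    case False
    then have "k - 1 < k" "1 \<le> k - 1" using k by auto
    then have "\<not> x \<le> grid_point R B ((k - 1) + 1)"
      using not_less_Least[of "k - 1" "\<lambda>k. x \<le> grid_point R B (k + 1) \<and> 1 \<le> k"]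
      by (auto simp: k_def)
    then show ?thesis using k by simp
  qed
  ultimately show ?thesis using k unfolding in_cell_def by blast
qed

lemma bernoulli_pmf_trivial:
  "bernoulli_pmf 0 = return_pmf False" "bernoulli_pmf 1 = return_pmf True"
  by (rule pmf_eqI, case_tac i, simp_all)+

lemma cell_round_adjacent:
  assumes "R > 0" "B \<ge> 1" "in_cell R B k x" "in_cell R B l x" "k < l"
  shows "cell_round R B k x = cell_round R B l x"
proof -
  have pos: "resolution R B > 0" using assms resolution_pos by blast
  have "grid_point R B l \<le> grid_point R B (k + 1)"
    using assms unfolding in_cell_def by linarith
  then have "l \<le> k + 1" using pos by (simp add: grid_point_def)
  then have l: "l = k + 1" using assms(5) by simp
  then have x: "x = grid_point R B (k + 1)" using assms(3,4) unfolding in_cell_def by simp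
  have "cell_round R B k x = return_pmf x"
    unfolding cell_round_def x grid_point_Suc using pos
    by (simp add: bernoulli_pmf_trivial map_return_pmf)
  moreover have "cell_round R B l x = return_pmf x"
    unfolding cell_round_def x l by (simp add: bernoulli_pmf_trivial map_return_pmf)
  ultimately show ?thesis by simp
qed

lemma stoch_round_eq:
  assumes "R > 0" "B \<ge> 1" "in_cell R B k x"
  shows "stoch_round R B x = cell_round R B k x"
proof -
  define l where "l = (SOME k. in_cell R B k x)"
  have "in_cell R B l x" unfolding l_def using assms(3) by (rule someI)
  then have "cell_round R B l x = cell_round R B k x"
    using assms cell_round_adjacent[of R B] by (metis linorder_neqE_nat)
  then show ?thesis by (simp add: stoch_round_def l_def)
qed

end

theory Submission
  imports Defs "HOL-Real_Asymp.Real_Asymp"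
begin

text \<open>Write \<open>X = A + E\<close>. Since \<open>A\<close> is arbitrary, \<open>\<parallel>X\<parallel>\<close> is not controlled and a net on the sphere
  alone does not suffice. However \<open>\<parallel>E\<parallel> \<le> C \<rho> \<surd>n\<close> with probability \<open>1 - e\<^bsup>-n\<^esup>\<close>, so if
  \<open>\<parallel>X x\<parallel> \<le> C \<rho> \<surd>n\<close> for a unit vector \<open>x\<close>, then \<open>A x\<close> lies in the ball of radius \<open>2 C \<rho> \<surd>n\<close>
  of the range of \<open>A\<close>, a space of dimension at most \<open>d\<close>. It is therefore enough to bound
  \<open>\<parallel>E x + w\<parallel>\<close> from below for \<open>x\<close> in a net of the unit ball of \<open>\<real>\<^sup>d\<close> and \<open>w\<close> in a net of that ball,
  which together have \<open>e\<^bsup>O(d)\<^esup>\<close> elements.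
  For fixed \<open>x\<close> and any fixed shift \<open>y\<close>, the Laplace transform of \<open>\<parallel>X x - y\<parallel>\<^sup>2\<close> factors over the rows,
  and symmetrization removes the shift; the column variance then gives
  \<open>\<parallel>X x - y\<parallel> \<ge> c \<rho> \<surd>n\<close> outside an event of probability \<open>e\<^bsup>-\<kappa> n\<^esup>\<close>, which beats the size of the nets
  as soon as \<open>d \<le> \<eta> n\<close> with \<open>\<eta>\<close> small.\<close>

section \<open>Nets of balls and coordinates on the range of a matrix\<close>

text \<open>Induction on \<open>L\<close> gives the exact value \<open>3 - 2 * (1/2) ^ L\<close>.
  The bound is uniform in \<open>L\<close> and becomes the base of \<open>3 ^ d\<close> in the count
  below.\<close>

lemma sum_half_power_abs_le: "(\<Sum>k\<in>{- int L..int L}. (1/2::real) ^ nat \<bar>k\<bar>) \<le> 3"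
proof -
  have "(\<Sum>k\<in>{- int L..int L}. (1/2::real) ^ nat \<bar>k\<bar>) = 3 - 2 * (1/2) ^ L"
  proof (induction L)
    case (Suc L)
    have "{- int (Suc L)..int (Suc L)} = insert (int (Suc L)) (insert (- int (Suc L)) {- int L..int L})"
      by auto
    with Suc show ?case by (simp add: nat_add_distrib)
  qed simp
  then show ?thesis by simp
qed

lemma half_power_nat_abs: "(1/2::real) ^ nat \<bar>k\<bar> = 2 powr (- real_of_int \<bar>k\<bar>)"
proof -
  have "(2::real) powr real (nat \<bar>k\<bar>) = 2 ^ nat \<bar>k\<bar>"
    by (rule powr_realpow) simp
  moreover have "real (nat \<bar>k\<bar>) = real_of_int \<bar>k\<bar>" by simp
  ultimately show ?thesis
    by (metis powr_minus power_one_over inverse_eq_divide)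
qed

text \<open>Counting by exponential weights: each member of \<open>Z\<close> has product weight at
  least \<open>2 powr (- T)\<close>, while the weight of the whole box factors over the coordinates
  and is at most \<open>3 ^ d\<close>. The cut-off \<open>L\<close> keeps the sums finite and does
  not enter the bound.\<close>

lemma card_int_vectors_le:
  fixes d L :: nat and T :: real
  defines "Z \<equiv> {z \<in> PiE {..<d} (\<lambda>_. {- int L..int L}). (\<Sum>i<d. real_of_int \<bar>z i\<bar>) \<le> T}"
  shows "finite Z" "real (card Z) \<le> 2 powr T * 3 ^ d"
proof -
  let ?P = "PiE {..<d} (\<lambda>_. {- int L..int L})"
  have finP: "finite ?P" by (intro finite_PiE) auto
  then show fin: "finite Z" unfolding Z_def by auto
  have w: "(\<Prod>i<d. (1/2::real) ^ nat \<bar>z i\<bar>) \<ge> 2 powr (- T)" if "z \<in> Z" for z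
  proof -
    have "(\<Prod>i<d. (1/2::real) ^ nat \<bar>z i\<bar>) = 2 powr (- (\<Sum>i<d. real_of_int \<bar>z i\<bar>))"
      unfolding half_power_nat_abs sum_negf[symmetric] by (rule powr_sum[symmetric]) auto
    also have "\<dots> \<ge> 2 powr (- T)" using that unfolding Z_def by auto
    finally show ?thesis .
  qed
  have "real (card Z) * 2 powr (- T) = (\<Sum>z\<in>Z. 2 powr (- T))" by simp
  also have "\<dots> \<le> (\<Sum>z\<in>Z. \<Prod>i<d. (1/2::real) ^ nat \<bar>z i\<bar>)"
    by (intro sum_mono w)
  also have "\<dots> \<le> (\<Sum>z\<in>?P. \<Prod>i<d. (1/2::real) ^ nat \<bar>z i\<bar>)"
    by (intro sum_mono2 finP prod_nonneg) (auto simp: Z_def)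
  also have "\<dots> = (\<Prod>i<d. \<Sum>k\<in>{- int L..int L}. (1/2::real) ^ nat \<bar>k\<bar>)"
    by (subst prod_sum_PiE) auto
  also have "\<dots> \<le> (\<Prod>i<d. 3)"
    by (intro prod_mono conjI sum_half_power_abs_le sum_nonneg) auto
  finally show "real (card Z) \<le> 2 powr T * 3 ^ d"
    by (simp add: powr_minus field_simps)
qed

lemma L2_set_power2: "(L2_set f A)\<^sup>2 = (\<Sum>i\<in>A. (f i)\<^sup>2)"
  by (simp add: L2_set_def sum_nonneg)

lemma L2_set_le_iff: "0 \<le> c \<Longrightarrow> L2_set f A \<le> c \<longleftrightarrow> (\<Sum>i\<in>A. (f i)\<^sup>2) \<le> c\<^sup>2"
  by (metis L2_set_power2 L2_set_nonneg abs_le_square_iff abs_of_nonneg)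

lemma L2_set_abs_mono: "(\<And>i. i \<in> A \<Longrightarrow> \<bar>f i\<bar> \<le> \<bar>g i\<bar>) \<Longrightarrow> L2_set f A \<le> L2_set g A"
  unfolding L2_set_def by (intro real_sqrt_le_mono sum_mono) (simp add: abs_le_square_iff)

lemma L2_set_scale: "L2_set (\<lambda>i. c * f i) A = \<bar>c\<bar> * L2_set f A"
  by (simp add: L2_set_def power_mult_distrib real_sqrt_mult flip: sum_distrib_left)

lemma sum_abs_le_sqrt_L2_set: "(\<Sum>i<d. \<bar>f i\<bar>) \<le> sqrt (real d) * L2_set f {..<d}"
  using L2_set_mult_ineq[of "\<lambda>_. 1" f "{..<d}"] by (simp add: L2_set_constant)

text \<open>The net consists of the points of a grid of mesh \<open>\<epsilon> / sqrt d\<close> that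
  lie in the ball. By Cauchy-Schwarz the integer coordinates have absolute sum at most
  \<open>d / \<epsilon>\<close>, which is linear in \<open>d\<close>, so the count is exponential in
  \<open>d\<close>. That \<open>K\<close> is chosen before \<open>d\<close> is what the union bounds
  rely on.\<close>

lemma ball_net:
  fixes \<epsilon> :: real
  assumes "\<epsilon> > 0"
  shows "\<exists>K\<ge>1. \<forall>d. \<exists>N :: (nat \<Rightarrow> real) set. finite N \<and> real (card N) \<le> K ^ d \<and>
    (\<forall>y\<in>N. L2_set y {..<d} \<le> 1) \<and>
    (\<forall>x. L2_set x {..<d} \<le> 1 \<longrightarrow> (\<exists>y\<in>N. L2_set (\<lambda>i. x i - y i) {..<d} \<le> \<epsilon>))"
proof -
  let ?K = "3 * 2 powr (1 / \<epsilon>)"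
  have "2 powr (1/\<epsilon>) \<ge> 1" using assms by (intro ge_one_powr_ge_zero) auto
  then have K: "?K \<ge> 1" by simp
  have "\<exists>N :: (nat \<Rightarrow> real) set. finite N \<and> real (card N) \<le> ?K ^ d \<and>
    (\<forall>y\<in>N. L2_set y {..<d} \<le> 1) \<and>
    (\<forall>x. L2_set x {..<d} \<le> 1 \<longrightarrow> (\<exists>y\<in>N. L2_set (\<lambda>i. x i - y i) {..<d} \<le> \<epsilon>))" for d :: nat
  proof (cases "d = 0")
    \<comment> \<open>Dimension 0 is separate because the mesh below divides by
      \<open>sqrt (real d)\<close>.\<close>
    case True
    then show ?thesis using assms by (intro exI[of _ "{\<lambda>_. 0}"]) auto
  next
    case False
    define \<delta> where "\<delta> = \<epsilon> / sqrt (real d)"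
    have \<delta>: "\<delta> > 0" using False assms by (simp add: \<delta>_def)
    define T where "T = real d / \<epsilon>"
    define L where "L = nat \<lceil>T\<rceil>"
    define Z where "Z = {z \<in> PiE {..<d} (\<lambda>_. {- int L..int L}). (\<Sum>i<d. real_of_int \<bar>z i\<bar>) \<le> T}"
    define F :: "(nat \<Rightarrow> int) \<Rightarrow> nat \<Rightarrow> real" where "F z i = \<delta> * real_of_int (z i)" for z i
    define N where "N = {y \<in> F ` Z. L2_set y {..<d} \<le> 1}"
    have finZ: "finite Z" and cZ: "real (card Z) \<le> 2 powr T * 3 ^ d"
      using card_int_vectors_le[of d L T] unfolding Z_def by auto
    have "card N \<le> card (F ` Z)" unfolding N_def by (intro card_mono) (auto simp: finZ)
    also have "\<dots> \<le> card Z" by (rule card_image_le[OF finZ])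
    finally have "real (card N) \<le> 2 powr T * 3 ^ d" using cZ by linarith
    also have "\<dots> = ?K ^ d"
      by (simp add: T_def power_mult_distrib powr_power)
    finally have card: "real (card N) \<le> ?K ^ d" .
    have approx: "\<exists>y\<in>N. L2_set (\<lambda>i. x i - y i) {..<d} \<le> \<epsilon>" if x: "L2_set x {..<d} \<le> 1" for x
    proof -
      \<comment> \<open>Rounding towards \<open>0\<close> does not increase any coordinate in modulus, so it stays in the ball.\<close>
      define z where "z = (\<lambda>i\<in>{..<d}. if x i \<ge> 0 then \<lfloor>x i / \<delta>\<rfloor> else - \<lfloor>- x i / \<delta>\<rfloor>)"
      have z: "\<bar>F z i\<bar> \<le> \<bar>x i\<bar> \<and> \<bar>x i - F z i\<bar> \<le> \<delta>" if "i < d" for i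
      proof -
        define w where "w = \<lfloor>\<bar>x i\<bar> / \<delta>\<rfloor>"
        have w: "real_of_int w \<le> \<bar>x i\<bar> / \<delta>" "\<bar>x i\<bar> / \<delta> < real_of_int w + 1" "0 \<le> w"
          unfolding w_def using \<delta> by auto
        have w': "\<delta> * real_of_int w \<le> \<bar>x i\<bar>" "\<bar>x i\<bar> < \<delta> * real_of_int w + \<delta>" "0 \<le> \<delta> * real_of_int w"
          using w \<delta> by (simp_all add: field_simps)
        show ?thesis
        proof (cases "x i \<ge> 0")
          case True
          then have "F z i = \<delta> * real_of_int w" using that by (simp add: F_def z_def w_def)
          then show ?thesis using w' True by linarith
        next
          case False
          then have "F z i = - (\<delta> * real_of_int w)" using that by (simp add: F_def z_def w_def)
          then show ?thesis using w' False by linarith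
        qed
      qed
      have zs: "real_of_int \<bar>z i\<bar> \<le> \<bar>x i\<bar> / \<delta>" if "i < d" for i
        using z[OF that] \<delta> by (simp add: F_def abs_mult field_simps)
      have "(\<Sum>i<d. real_of_int \<bar>z i\<bar>) \<le> (\<Sum>i<d. \<bar>x i\<bar> / \<delta>)"
        by (intro sum_mono zs) auto
      also have "\<dots> = (\<Sum>i<d. \<bar>x i\<bar>) / \<delta>" by (simp add: sum_divide_distrib)
      also have "\<dots> \<le> sqrt (real d) * 1 / \<delta>"
        using sum_abs_le_sqrt_L2_set[of x d] x \<delta>
        by (intro divide_right_mono order.trans[OF sum_abs_le_sqrt_L2_set] mult_left_mono) auto
      also have "\<dots> = T" using False assms by (simp add: \<delta>_def T_def field_simps)
      finally have sumT: "(\<Sum>i<d. real_of_int \<bar>z i\<bar>) \<le> T" .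
      have "z i \<in> {- int L..int L}" if "i < d" for i
      proof -
        have "real_of_int \<bar>z i\<bar> \<le> (\<Sum>i<d. real_of_int \<bar>z i\<bar>)"
          using that by (intro member_le_sum) auto
        then have "real_of_int \<bar>z i\<bar> \<le> real_of_int \<lceil>T\<rceil>" using sumT by linarith
        moreover have "0 \<le> T" using assms by (simp add: T_def)
        ultimately show ?thesis unfolding L_def by auto
      qed
      then have "z \<in> Z" unfolding Z_def using sumT by (auto simp: z_def)
      moreover have "L2_set (F z) {..<d} \<le> 1"
        using z x by (intro order.trans[OF L2_set_abs_mono[of _ "F z" x]]) auto
      ultimately have "F z \<in> N" by (auto simp: N_def)
      moreover have "L2_set (\<lambda>i. x i - F z i) {..<d} \<le> L2_set (\<lambda>_. \<delta>) {..<d}"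
        using z by (intro L2_set_abs_mono) force
      then have "L2_set (\<lambda>i. x i - F z i) {..<d} \<le> \<epsilon>"
        using assms False by (simp add: L2_set_constant \<delta>_def)
      ultimately show ?thesis by blast
    qed
    show ?thesis
      using card approx finZ by (intro exI[of _ N]) (auto simp: N_def)
  qed
  with K show ?thesis by blast
qed

section \<open>Orthonormal coordinates on a column space\<close>

lemma sum_linear_combination_mult:
  fixes a :: "'a \<Rightarrow> real"
  shows "(\<Sum>m\<in>B. (\<Sum>i\<in>A. a i * f i m) * g m) = (\<Sum>i\<in>A. a i * (\<Sum>m\<in>B. f i m * g m))"
proof -
  have "(\<Sum>m\<in>B. (\<Sum>i\<in>A. a i * f i m) * g m) = (\<Sum>m\<in>B. \<Sum>i\<in>A. a i * (f i m * g m))"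
    by (simp add: sum_distrib_right mult.assoc)
  also have "\<dots> = (\<Sum>i\<in>A. \<Sum>m\<in>B. a i * (f i m * g m))" by (rule sum.swap)
  finally show ?thesis by (simp add: sum_distrib_left)
qed

text \<open>Admitting zero vectors keeps exactly \<open>k\<close> vectors even when the family to be
  orthonormalized is dependent, so a rank-deficient matrix needs no case distinction.\<close>

definition orthonormal_or_zero :: "nat \<Rightarrow> nat \<Rightarrow> (nat \<Rightarrow> nat \<Rightarrow> real) \<Rightarrow> bool" where
  "orthonormal_or_zero n k u \<longleftrightarrow> (\<forall>i<k. \<forall>j<k. i \<noteq> j \<longrightarrow> (\<Sum>l<n. u i l * u j l) = 0) \<and>
     (\<forall>i<k. (\<Sum>l<n. (u i l)\<^sup>2) \<in> {0, 1})"

text \<open>Pythagoras: the cross terms of the expanded square vanish by orthogonality. The squared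
  norms stay in the formula because some of them may be 0.\<close>

lemma L2_set_orthonormal_or_zero:
  assumes "orthonormal_or_zero n k u"
  shows "(L2_set (\<lambda>l. \<Sum>i<k. c i * u i l) {..<n})\<^sup>2 = (\<Sum>i<k. (c i)\<^sup>2 * (\<Sum>l<n. (u i l)\<^sup>2))"
proof -
  have "(L2_set (\<lambda>l. \<Sum>i<k. c i * u i l) {..<n})\<^sup>2 = (\<Sum>l<n. \<Sum>i<k. \<Sum>j<k. c i * c j * (u i l * u j l))"
    unfolding L2_set_power2 by (simp add: power2_eq_square sum_product mult_ac)
  also have "\<dots> = (\<Sum>i<k. \<Sum>l<n. \<Sum>j<k. c i * c j * (u i l * u j l))" by (rule sum.swap)
  also have "\<dots> = (\<Sum>i<k. \<Sum>j<k. \<Sum>l<n. c i * c j * (u i l * u j l))"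
    by (intro sum.cong refl sum.swap)
  also have "\<dots> = (\<Sum>i<k. \<Sum>j<k. if i = j then (c i)\<^sup>2 * (\<Sum>l<n. (u i l)\<^sup>2) else 0)"
    using assms unfolding orthonormal_or_zero_def
    by (intro sum.cong refl) (auto simp: sum_distrib_left[symmetric] power2_eq_square)
  finally show ?thesis by simp
qed

lemma L2_set_orthonormal_or_zero_le:
  assumes "orthonormal_or_zero n k u"
  shows "L2_set (\<lambda>l. \<Sum>i<k. c i * u i l) {..<n} \<le> L2_set c {..<k}"
proof -
  have "(\<Sum>i<k. (c i)\<^sup>2 * (\<Sum>l<n. (u i l)\<^sup>2)) \<le> (\<Sum>i<k. (c i)\<^sup>2 * 1)"
    using assms unfolding orthonormal_or_zero_def by (intro sum_mono mult_left_mono) force+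
  then have "(L2_set (\<lambda>l. \<Sum>i<k. c i * u i l) {..<n})\<^sup>2 \<le> (L2_set c {..<k})\<^sup>2"
    unfolding L2_set_orthonormal_or_zero[OF assms] L2_set_power2[of c] by simp
  then show ?thesis by (rule power2_le_imp_le) simp
qed

text \<open>Gram--Schmidt without any independence assumption: a vector that is already in the span
  contributes the zero vector (here \<open>x / 0 = 0\<close> is used on purpose).\<close>

lemma ex_orthonormal_or_zero:
  fixes v :: "nat \<Rightarrow> nat \<Rightarrow> real"
  shows "\<exists>u. orthonormal_or_zero n k u \<and>
    (\<forall>j<k. \<forall>l<n. v j l = (\<Sum>i<k. (\<Sum>m<n. v j m * u i m) * u i l))"
proof (induction k)
  case 0
  then show ?case by (auto simp: orthonormal_or_zero_def)
next
  case (Suc k)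
  then obtain u where u: "orthonormal_or_zero n k u"
    and span: "\<And>j l. j < k \<Longrightarrow> l < n \<Longrightarrow> v j l = (\<Sum>i<k. (\<Sum>m<n. v j m * u i m) * u i l)"
    by blast
  define r where "r l = v k l - (\<Sum>i<k. (\<Sum>m<n. v k m * u i m) * u i l)" for l
  define s where "s = L2_set r {..<n}"
  define e where "e l = r l / s" for l
  define u' where "u' = u(k := e)"
  have inner: "(\<Sum>l<n. (\<Sum>i<k. c i * u i l) * u j l) = c j * (\<Sum>l<n. (u j l)\<^sup>2)" if "j < k" for c j
  proof -
    have "(\<Sum>l<n. (\<Sum>i<k. c i * u i l) * u j l) = (\<Sum>i<k. c i * (\<Sum>l<n. u i l * u j l))"
      by (rule sum_linear_combination_mult)
    also have "\<dots> = (\<Sum>i<k. if i = j then c j * (\<Sum>l<n. (u j l)\<^sup>2) else 0)"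
      using u that unfolding orthonormal_or_zero_def
      by (intro sum.cong refl) (auto simp: power2_eq_square)
    finally show ?thesis using that by simp
  qed
  have zero: "u j l = 0" if "(\<Sum>l<n. (u j l)\<^sup>2) = 0" "l < n" for j l
    using that by (subst (asm) sum_nonneg_eq_0_iff) auto
  have r_orth: "(\<Sum>l<n. r l * u j l) = 0" if j: "j < k" for j
  proof -
    \<comment> \<open>The product vanishes for two different reasons: the second factor is 0 if
      \<open>u j\<close> has norm 1, and the first is 0 if \<open>u j\<close> is the zero
      vector.\<close>
    have "(\<Sum>l<n. r l * u j l) = (\<Sum>m<n. v k m * u j m) * (1 - (\<Sum>l<n. (u j l)\<^sup>2))"
      using inner[OF j, of "\<lambda>i. \<Sum>m<n. v k m * u i m"]
      by (simp add: r_def left_diff_distrib sum_subtractf algebra_simps)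
    moreover have "(\<Sum>m<n. v k m * u j m) = 0" if "(\<Sum>l<n. (u j l)\<^sup>2) = 0"
      using zero[OF that] by simp
    ultimately show ?thesis using u j unfolding orthonormal_or_zero_def by auto
  qed
  have e_orth: "(\<Sum>l<n. e l * u j l) = 0" if j: "j < k" for j
  proof -
    have "(\<Sum>l<n. e l * u j l) = (\<Sum>l<n. r l * u j l) / s"
      by (simp add: e_def sum_divide_distrib)
    then show ?thesis using r_orth[OF j] by simp
  qed
  have r_zero: "r l = 0" if "s = 0" "l < n" for l
    using that unfolding s_def by (simp add: L2_set_eq_0_iff)
  have e_norm: "(\<Sum>l<n. (e l)\<^sup>2) \<in> {0, 1}"
  proof (cases "s = 0")
    case False
    then have "(\<Sum>l<n. (e l)\<^sup>2) = (\<Sum>l<n. (r l)\<^sup>2) / s\<^sup>2"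
      by (simp add: e_def sum_divide_distrib power_divide)
    then show ?thesis using False by (simp add: s_def L2_set_power2[symmetric])
  qed (simp add: e_def)
  have ons: "orthonormal_or_zero n (Suc k) u'"
    using u e_orth e_norm unfolding orthonormal_or_zero_def u'_def
    by (auto simp: less_Suc_eq mult.commute)
  have "v j l = (\<Sum>i<Suc k. (\<Sum>m<n. v j m * u' i m) * u' i l)" if j: "j < Suc k" and l: "l < n" for j l
  proof (cases "j = k")
    case False
    then have j: "j < k" using j by simp
    \<comment> \<open>An old vector lies in the span of the old \<open>u i\<close>, all orthogonal
      to \<open>e\<close>, so the new direction contributes nothing to it.\<close>
    have "(\<Sum>m<n. v j m * e m) = (\<Sum>m<n. (\<Sum>i<k. (\<Sum>m'<n. v j m' * u i m') * u i m) * e m)"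
      by (intro sum.cong refl arg_cong2[where f="(*)"] span j) auto
    also have "\<dots> = (\<Sum>i<k. (\<Sum>m'<n. v j m' * u i m') * (\<Sum>m<n. u i m * e m))"
      by (rule sum_linear_combination_mult)
    also have "\<dots> = 0" using e_orth by (simp add: mult.commute[of "u _ _"])
    finally show ?thesis using span[OF j l] by (simp add: u'_def)
  next
    case True
    have "(\<Sum>m<n. v k m * e m) = (\<Sum>m<n. r m * e m)
        + (\<Sum>m<n. (\<Sum>i<k. (\<Sum>m'<n. v k m' * u i m') * u i m) * e m)"
      by (simp add: r_def algebra_simps sum_subtractf)
    also have "(\<Sum>m<n. (\<Sum>i<k. (\<Sum>m'<n. v k m' * u i m') * u i m) * e m)
        = (\<Sum>i<k. (\<Sum>m'<n. v k m' * u i m') * (\<Sum>m<n. u i m * e m))"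
      by (rule sum_linear_combination_mult)
    also have "\<dots> = 0" using e_orth by (simp add: mult.commute[of "u _ _"])
    also have "(\<Sum>m<n. r m * e m) = (\<Sum>m<n. (r m)\<^sup>2) / s"
      by (simp add: e_def sum_divide_distrib power2_eq_square)
    also have "\<dots> = s" by (simp add: s_def L2_set_power2[symmetric] power2_eq_square[of "L2_set r {..<n}"])
    \<comment> \<open>The coefficient of \<open>v k\<close> on \<open>e\<close> is \<open>s\<close>.
      The identity survives \<open>s = 0\<close>, since then \<open>r\<close> vanishes on all
      indices below \<open>n\<close>.\<close>
    finally have "(\<Sum>m<n. v k m * e m) * e l = r l"
      using r_zero[OF _ l] by (cases "s = 0") (auto simp: e_def)
    then show ?thesis using True by (simp add: u'_def r_def)
  qed
  with ons show ?case by blast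
qed

text \<open>Applied to the columns of \<open>A\<close>, this transports nets of balls of dimension
  \<open>d\<close> to the range of \<open>A\<close>: the map from coefficients to vectors is a
  contraction, and each vector of the range has coefficients of the same norm. The size of the net
  is thus governed by \<open>d\<close>, although the range lies in dimension
  \<open>n\<close>.\<close>

lemma ex_range_coordinates:
  fixes v :: "nat \<Rightarrow> nat \<Rightarrow> real"
  obtains u :: "nat \<Rightarrow> nat \<Rightarrow> real" where
    "\<And>c. L2_set (\<lambda>l. \<Sum>i<d. c i * u i l) {..<n} \<le> L2_set c {..<d}"
    "\<And>x. \<exists>c. L2_set c {..<d} = L2_set (\<lambda>l. \<Sum>j<d. x j * v j l) {..<n} \<and>
           (\<forall>l<n. (\<Sum>j<d. x j * v j l) = (\<Sum>i<d. c i * u i l))"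
proof -
  obtain u where u: "orthonormal_or_zero n d u"
    and span: "\<And>j l. j < d \<Longrightarrow> l < n \<Longrightarrow> v j l = (\<Sum>i<d. (\<Sum>m<n. v j m * u i m) * u i l)"
    using ex_orthonormal_or_zero[of n d v] by blast
  show thesis
  proof (rule that[of u])
    fix c show "L2_set (\<lambda>l. \<Sum>i<d. c i * u i l) {..<n} \<le> L2_set c {..<d}"
      by (rule L2_set_orthonormal_or_zero_le[OF u])
  next
    fix x
    define w where "w l = (\<Sum>j<d. x j * v j l)" for l
    define c where "c i = (\<Sum>m<n. w m * u i m)" for i
    have w: "w l = (\<Sum>i<d. c i * u i l)" if l: "l < n" for l
    proof -
      have c: "c i = (\<Sum>j<d. x j * (\<Sum>m<n. v j m * u i m))" for i
        unfolding c_def w_def by (rule sum_linear_combination_mult)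
      have "w l = (\<Sum>j<d. x j * (\<Sum>i<d. (\<Sum>m<n. v j m * u i m) * u i l))"
        unfolding w_def using span[OF _ l] by (intro sum.cong refl) auto
      also have "\<dots> = (\<Sum>i<d. (\<Sum>j<d. x j * (\<Sum>m<n. v j m * u i m)) * u i l)"
        by (rule sum_linear_combination_mult[symmetric])
      finally show ?thesis by (simp only: c)
    qed
    \<comment> \<open>Parseval: expanding one of the two factors \<open>w m\<close> in the
      \<open>u i\<close> leaves the coefficients \<open>c i\<close> paired with themselves.\<close>
    have "(L2_set w {..<n})\<^sup>2 = (\<Sum>m<n. w m * w m)"
      unfolding L2_set_power2 by (simp add: power2_eq_square)
    also have "\<dots> = (\<Sum>m<n. w m * (\<Sum>i<d. c i * u i m))"
      by (intro sum.cong refl arg_cong[of _ _ "(*) _"] w) auto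
    also have "\<dots> = (\<Sum>m<n. (\<Sum>i<d. c i * u i m) * w m)" by (simp only: mult.commute)
    also have "\<dots> = (\<Sum>i<d. c i * (\<Sum>m<n. u i m * w m))" by (rule sum_linear_combination_mult)
    also have "\<dots> = (\<Sum>i<d. c i * c i)" by (simp only: c_def mult.commute)
    also have "\<dots> = (L2_set c {..<d})\<^sup>2" unfolding L2_set_power2 by (simp add: power2_eq_square)
    finally have "L2_set c {..<d} = L2_set w {..<n}" by simp
    then show "\<exists>c. L2_set c {..<d} = L2_set (\<lambda>l. \<Sum>j<d. x j * v j l) {..<n} \<and>
           (\<forall>l<n. (\<Sum>j<d. x j * v j l) = (\<Sum>i<d. c i * u i l))"
      using w unfolding w_def by (intro exI[of _ c]) auto
  qed
qed

section \<open>Moment bounds for independent bounded variables\<close>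

text \<open>The third-order Taylor remainder carries the factor \<open>(- s) ^ 3\<close> and is
  therefore not positive.\<close>

lemma exp_minus_le_quadratic:
  fixes s :: real
  assumes "0 \<le> s"
  shows "exp (- s) \<le> 1 - s + s\<^sup>2 / 2"
proof -
  obtain t where "exp (- s) = (\<Sum>m<3. (- s) ^ m / fact m) + exp t / fact 3 * (- s) ^ 3"
    using Maclaurin_exp_le[of "- s" 3] by blast
  moreover have "exp t / fact 3 * (- s) ^ 3 \<le> 0"
    using assms by (intro mult_nonneg_nonpos) auto
  ultimately show ?thesis by (simp add: numeral_3_eq_3 power2_eq_square)
qed

text \<open>Adding the Taylor bounds at \<open>x\<close> and \<open>- x\<close> cancels the odd
  terms and leaves \<open>2 + x\<^sup>2 + x ^ 4 / 12\<close>. Stopping before order 6 makes the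
  remainder an even power, hence nonnegative. This turns exponential moments into a fourth
  moment.\<close>

lemma power4_le_exp: "(x::real) ^ 4 \<le> 12 * (exp x + exp (- x))"
proof -
  have *: "exp y \<ge> 1 + y + y\<^sup>2 / 2 + y ^ 3 / 6 + y ^ 4 / 24 + y ^ 5 / 120" for y :: real
  proof -
    obtain t where "exp y = (\<Sum>m<6. y ^ m / fact m) + exp t / fact 6 * y ^ 6"
      using Maclaurin_exp_le[of y 6] by blast
    moreover have "exp t / fact 6 * y ^ 6 \<ge> 0" by simp
    ultimately show ?thesis by (simp add: eval_nat_numeral fact_numeral)
  qed
  have "exp (- x) \<ge> 1 - x + x\<^sup>2 / 2 - x ^ 3 / 6 + x ^ 4 / 24 - x ^ 5 / 120"
    using *[of "- x"] by (simp add: power_minus_odd)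
  then show ?thesis using *[of x] zero_le_power2[of x] by argo
qed

section \<open>Exponential moments and tails of independent bounded variables\<close>

lemma pmf_Chernoff:
  assumes fin: "finite (set_pmf p)"
  shows "measure_pmf.prob p {x. t \<le> f x} \<le> exp (- t) * measure_pmf.expectation p (\<lambda>x. exp (f x))"
proof -
  have "measure_pmf.prob p {x \<in> space (measure_pmf p). exp t \<le> exp (f x)}
      \<le> measure_pmf.expectation p (\<lambda>x. exp (f x)) / exp t"
    by (rule integral_Markov_inequality_measure[of _ _ UNIV])
       (auto intro: integrable_measure_pmf_finite fin)
  then show ?thesis by (simp add: exp_minus field_simps)
qed

text \<open>Hoeffding's lemma for either sign of \<open>t\<close>. The inner claim treats
  \<open>t > 0\<close>; a negative \<open>t\<close> is reduced to it by reflecting the law, whose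
  values then lie in an interval of the same length starting at \<open>- (l + \<rho>)\<close>. The
  finite support makes every function integrable.\<close>

lemma pmf_Hoeffding_mgf:
  fixes p :: "real pmf"
  assumes fin: "finite (set_pmf p)" and sub: "set_pmf p \<subseteq> {l..l + \<rho>}"
  shows "measure_pmf.expectation p (\<lambda>x. exp (t * (x - measure_pmf.expectation p (\<lambda>x. x))))
           \<le> exp (t\<^sup>2 * \<rho>\<^sup>2 / 8)"
proof -
  have *: "measure_pmf.expectation q (\<lambda>x. exp (t * (x - measure_pmf.expectation q (\<lambda>x. x))))
           \<le> exp (t\<^sup>2 * \<rho>\<^sup>2 / 8)"
    if fin: "finite (set_pmf q)" and sub: "set_pmf q \<subseteq> {l..l + \<rho>}" and t: "t > 0"
    for q :: "real pmf" and l t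
  proof -
    interpret interval_bounded_random_variable "measure_pmf q" "\<lambda>x. x" l "l + \<rho>"
    proof unfold_locales
      show "AE x in measure_pmf q. x \<in> {l..l + \<rho>}" using sub by (intro AE_pmfI) blast
    qed simp
    have "nn_integral q (\<lambda>x. exp (t * (x - measure_pmf.expectation q (\<lambda>x. x))))
        \<le> ennreal (exp (t\<^sup>2 * \<rho>\<^sup>2 / 8))"
      using Hoeffdings_lemma_nn_integral[OF t] by simp
    then show ?thesis
      by (subst (asm) nn_integral_eq_integral) (auto intro: integrable_measure_pmf_finite fin)
  qed
  consider "t > 0" | "t = 0" | "t < 0" by linarith
  then show ?thesis
  proof cases
    case 1 then show ?thesis using *[OF fin sub] by blast
  next
    case 3
    have "measure_pmf.expectation (map_pmf uminus p)
        (\<lambda>x. exp ((- t) * (x - measure_pmf.expectation (map_pmf uminus p) (\<lambda>x. x))))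
           \<le> exp ((- t)\<^sup>2 * \<rho>\<^sup>2 / 8)"
      using 3 sub fin by (intro *[of _ "- (l + \<rho>)"]) auto
    then show ?thesis by (simp add: algebra_simps)
  qed simp
qed

text \<open>The exponential of the sum factors over the independent coordinates, and coordinate
  \<open>k\<close> is handled by Hoeffding's lemma with parameter \<open>t * a k\<close>.\<close>

lemma Pi_pmf_Hoeffding_mgf:
  fixes p :: "'a \<Rightarrow> real pmf"
  assumes S: "finite S"
    and fin: "\<And>k. k \<in> S \<Longrightarrow> finite (set_pmf (p k))"
    and sub: "\<And>k. k \<in> S \<Longrightarrow> set_pmf (p k) \<subseteq> {l k..l k + \<rho>}"
  shows "measure_pmf.expectation (Pi_pmf S dflt p)
      (\<lambda>X. exp (t * (\<Sum>k\<in>S. a k * (X k - measure_pmf.expectation (p k) (\<lambda>x. x)))))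
    \<le> exp (t\<^sup>2 * \<rho>\<^sup>2 * (\<Sum>k\<in>S. (a k)\<^sup>2) / 8)"
proof -
  let ?m = "\<lambda>k. measure_pmf.expectation (p k) (\<lambda>x. x)"
  have "measure_pmf.expectation (Pi_pmf S dflt p) (\<lambda>X. exp (t * (\<Sum>k\<in>S. a k * (X k - ?m k))))
      = measure_pmf.expectation (Pi_pmf S dflt p) (\<lambda>X. \<Prod>k\<in>S. exp ((t * a k) * (X k - ?m k)))"
    by (simp add: exp_sum[OF S, symmetric] sum_distrib_left mult.assoc)
  also have "\<dots> = (\<Prod>k\<in>S. measure_pmf.expectation (p k) (\<lambda>x. exp ((t * a k) * (x - ?m k))))"
    by (rule expectation_prod_Pi_pmf[OF S]) (auto intro: integrable_measure_pmf_finite fin)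
  also have "\<dots> \<le> (\<Prod>k\<in>S. exp ((t * a k)\<^sup>2 * \<rho>\<^sup>2 / 8))"
    by (intro prod_mono conjI pmf_Hoeffding_mgf[OF fin sub] Bochner_Integration.integral_nonneg) auto
  also have "\<dots> = exp (t\<^sup>2 * \<rho>\<^sup>2 * (\<Sum>k\<in>S. (a k)\<^sup>2) / 8)"
    by (simp add: exp_sum[OF S, symmetric] sum_distrib_left sum_divide_distrib power_mult_distrib mult_ac)
  finally show ?thesis .
qed

lemma finite_set_Pi_pmf:
  assumes "finite S" "\<And>k. k \<in> S \<Longrightarrow> finite (set_pmf (p k))"
  shows "finite (set_pmf (Pi_pmf S dflt p))"
  using assms by (simp add: set_Pi_pmf finite_PiE_dflt)

lemma Pi_pmf_Hoeffding_tail: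
  fixes p :: "'a \<Rightarrow> real pmf"
  assumes S: "finite S" and "\<rho> > 0" "0 \<le> t"
    and fin: "\<And>k. k \<in> S \<Longrightarrow> finite (set_pmf (p k))"
    and sub: "\<And>k. k \<in> S \<Longrightarrow> set_pmf (p k) \<subseteq> {l k..l k + \<rho>}"
    and a: "(\<Sum>k\<in>S. (a k)\<^sup>2) \<le> 1"
  shows "measure_pmf.prob (Pi_pmf S dflt p)
      {X. t \<le> (\<Sum>k\<in>S. a k * (X k - measure_pmf.expectation (p k) (\<lambda>x. x)))}
    \<le> exp (- 2 * t\<^sup>2 / \<rho>\<^sup>2)"
proof (cases "t = 0")
  case False
  let ?m = "\<lambda>k. measure_pmf.expectation (p k) (\<lambda>x. x)"
  let ?f = "\<lambda>X. \<Sum>k\<in>S. a k * (X k - ?m k)"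
  \<comment> \<open>This \<open>s\<close> minimizes
    \<open>- (s * t) + s\<^sup>2 * \<rho>\<^sup>2 / 8\<close>. It has to be positive for the
    rescaling of the event, so \<open>t = 0\<close>, where the bound is 1, is treated apart.\<close>
  define s where "s = 4 * t / \<rho>\<^sup>2"
  have s: "s > 0" using assms False by (simp add: s_def)
  have "measure_pmf.prob (Pi_pmf S dflt p) {X. t \<le> ?f X}
      = measure_pmf.prob (Pi_pmf S dflt p) {X. s * t \<le> s * ?f X}"
    using s by simp
  also have "\<dots> \<le> exp (- (s * t)) * measure_pmf.expectation (Pi_pmf S dflt p) (\<lambda>X. exp (s * ?f X))"
    by (intro pmf_Chernoff finite_set_Pi_pmf S fin)
  also have "\<dots> \<le> exp (- (s * t)) * exp (s\<^sup>2 * \<rho>\<^sup>2 * (\<Sum>k\<in>S. (a k)\<^sup>2) / 8)"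
    by (rule mult_left_mono[OF Pi_pmf_Hoeffding_mgf[OF S fin sub]]) auto
  also have "\<dots> \<le> exp (- (s * t)) * exp (s\<^sup>2 * \<rho>\<^sup>2 * 1 / 8)"
    using mult_left_mono[OF a, of "s\<^sup>2 * \<rho>\<^sup>2"] by simp
  also have "\<dots> = exp (- (s * t) + s\<^sup>2 * \<rho>\<^sup>2 * 1 / 8)" by (rule exp_add[symmetric])
  also have "- (s * t) + s\<^sup>2 * \<rho>\<^sup>2 * 1 / 8 = - 2 * t\<^sup>2 / \<rho>\<^sup>2"
  proof -
    have "s * \<rho>\<^sup>2 = 4 * t" using \<open>\<rho> > 0\<close> by (simp add: s_def)
    then have "s\<^sup>2 * \<rho>\<^sup>2 = 4 * (s * t)" by (metis mult.assoc mult.left_commute power2_eq_square)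
    then have "- (s * t) + s\<^sup>2 * \<rho>\<^sup>2 * 1 / 8 = - (s * t / 2)" by simp
    also have "\<dots> = - 2 * t\<^sup>2 / \<rho>\<^sup>2" by (simp add: s_def power2_eq_square)
    finally show ?thesis .
  qed
  finally show ?thesis .
qed simp

section \<open>Laplace transform of a shifted square\<close>

text \<open>The shift of \<open>u\<close> is eliminated by passing to an independent copy \<open>u'\<close>:
  \<open>u\<^sup>2 + u'\<^sup>2 \<ge> (u - u')\<^sup>2 / 2\<close>.\<close>

lemma expectation_exp_neg_square_le:
  fixes u :: "'a \<Rightarrow> real"
  assumes fin: "finite (set_pmf p)" and lam: "0 \<le> lam"
    and m: "measure_pmf.expectation p u = m"
    and v: "measure_pmf.expectation p (\<lambda>x. (u x - m)\<^sup>2) = v"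
    and K: "measure_pmf.expectation p (\<lambda>x. (u x - m) ^ 4) \<le> K"
  shows "measure_pmf.expectation p (\<lambda>x. exp (- (lam * (u x)\<^sup>2))) \<le> exp (- (lam * v - 2 * lam\<^sup>2 * K) / 2)"
proof -
  let ?S = "set_pmf p"
  \<comment> \<open>Writing expectations as weighted sums over the support turns the pair of
    independent copies into a double sum.\<close>
  define w where "w = pmf p"
  define z where "z x = u x - m" for x
  have E: "measure_pmf.expectation p f = (\<Sum>x\<in>?S. w x * f x)" for f :: "'a \<Rightarrow> real"
    by (subst integral_measure_pmf_real[OF fin]) (auto simp: w_def mult.commute)
  have w1: "(\<Sum>x\<in>?S. w x) = 1" using E[of "\<lambda>_. 1"] by simp
  have w0: "w x \<ge> 0" for x by (simp add: w_def)
  have z1: "(\<Sum>x\<in>?S. w x * z x) = 0"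
    using m w1 unfolding E z_def by (simp add: right_diff_distrib sum_subtractf sum_distrib_right[symmetric])
  have z2: "(\<Sum>x\<in>?S. w x * (z x)\<^sup>2) = v" using v unfolding E z_def .
  have z4: "(\<Sum>x\<in>?S. w x * z x ^ 4) \<le> K" using K unfolding E z_def .
  define e where "e x = exp (- (lam * (u x)\<^sup>2))" for x
  \<comment> \<open>The right side involves only the centred values:
    \<open>z x - z y = u x - u y\<close>, so the mean has disappeared. On averaging, the quadratic
    term will yield \<open>- lam * v\<close>.\<close>
  have pw: "e x * e y \<le> 1 - lam / 2 * (z x - z y)\<^sup>2 + lam\<^sup>2 * (z x ^ 4 + z y ^ 4)" for x y
  proof -
    have sq: "(u x)\<^sup>2 + (u y)\<^sup>2 \<ge> (z x - z y)\<^sup>2 / 2"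
      using zero_le_power2[of "u x + u y"] by (simp add: z_def power2_eq_square algebra_simps)
    have "e x * e y = exp (- (lam * ((u x)\<^sup>2 + (u y)\<^sup>2)))"
      by (simp add: e_def exp_add[symmetric] algebra_simps)
    also have "\<dots> \<le> exp (- (lam * ((z x - z y)\<^sup>2 / 2)))"
      using mult_left_mono[OF sq lam] by simp
    also have "\<dots> \<le> 1 - lam * ((z x - z y)\<^sup>2 / 2) + (lam * ((z x - z y)\<^sup>2 / 2))\<^sup>2 / 2"
      by (rule exp_minus_le_quadratic) (use lam in simp)
    also have "(lam * ((z x - z y)\<^sup>2 / 2))\<^sup>2 / 2 = lam\<^sup>2 * ((z x - z y) ^ 4 / 8)"
      by (simp add: power_mult_distrib power_divide flip: power_mult)
    also have "(z x - z y) ^ 4 / 8 \<le> z x ^ 4 + z y ^ 4"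
    proof -
      have "(z x - z y)\<^sup>2 \<le> 2 * ((z x)\<^sup>2 + (z y)\<^sup>2)"
        using zero_le_power2[of "z x + z y"] by (simp add: power2_eq_square algebra_simps)
      then have "((z x - z y)\<^sup>2)\<^sup>2 \<le> (2 * ((z x)\<^sup>2 + (z y)\<^sup>2))\<^sup>2" by (rule power_mono) simp
      also have "\<dots> = 4 * ((z x)\<^sup>2 + (z y)\<^sup>2)\<^sup>2" by (simp only: power_mult_distrib) simp
      also have "\<dots> \<le> 4 * (2 * (((z x)\<^sup>2)\<^sup>2 + ((z y)\<^sup>2)\<^sup>2))"
        using zero_le_power2[of "(z x)\<^sup>2 - (z y)\<^sup>2"] by (simp add: power2_eq_square algebra_simps)
      finally show ?thesis by (simp flip: power_mult)
    qed
    finally show ?thesis by (simp add: mult_left_mono)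
  qed
  have prod: "(\<Sum>x\<in>?S. \<Sum>y\<in>?S. w x * w y * (f x * g y)) = (\<Sum>x\<in>?S. w x * f x) * (\<Sum>y\<in>?S. w y * g y)"
    for f g :: "'a \<Rightarrow> real"
    by (simp add: sum_product mult_ac)
  have "(measure_pmf.expectation p e)\<^sup>2 = (\<Sum>x\<in>?S. \<Sum>y\<in>?S. w x * w y * (e x * e y))"
    unfolding E prod by (simp add: power2_eq_square)
  also have "\<dots> \<le> (\<Sum>x\<in>?S. \<Sum>y\<in>?S. w x * w y *
      (1 - lam / 2 * (z x - z y)\<^sup>2 + lam\<^sup>2 * (z x ^ 4 + z y ^ 4)))"
    by (intro sum_mono mult_left_mono pw mult_nonneg_nonneg w0)
  also have "\<dots> = (\<Sum>x\<in>?S. \<Sum>y\<in>?S. w x * w y * (1 * 1) - lam / 2 * (w x * w y * ((z x)\<^sup>2 * 1))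
      - lam / 2 * (w x * w y * (1 * (z y)\<^sup>2)) + lam * (w x * w y * (z x * z y))
      + lam\<^sup>2 * (w x * w y * (z x ^ 4 * 1)) + lam\<^sup>2 * (w x * w y * (1 * z y ^ 4)))"
    by (intro sum.cong refl) (simp add: power2_diff algebra_simps)
  \<comment> \<open>The mixed term \<open>z x * z y\<close> averages to 0 because \<open>z\<close>
    is centred.\<close>
  also have "\<dots> = 1 - lam / 2 * v - lam / 2 * v + lam * 0
      + lam\<^sup>2 * (\<Sum>x\<in>?S. w x * z x ^ 4) + lam\<^sup>2 * (\<Sum>x\<in>?S. w x * z x ^ 4)"
    unfolding sum.distrib sum_subtractf sum_distrib_left[symmetric] prod
    by (simp add: w1 z1 z2)
  also have "\<dots> \<le> 1 - lam * v + 2 * (lam\<^sup>2 * K)"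
    using mult_left_mono[OF z4, of "lam\<^sup>2"] by simp
  also have "\<dots> \<le> exp (- (lam * v - 2 * lam\<^sup>2 * K))"
    using exp_ge_add_one_self[of "- (lam * v - 2 * lam\<^sup>2 * K)"] by (simp add: algebra_simps)
  \<comment> \<open>The estimate so far concerns the square of the expectation; extracting the root
    is the source of the division by 2 in the exponent.\<close>
  also have "\<dots> = (exp (- (lam * v - 2 * lam\<^sup>2 * K) / 2))\<^sup>2"
    by (subst exp_double[symmetric]) simp
  finally show ?thesis
    unfolding e_def by (rule power2_le_imp_le) simp
qed

section \<open>First, second and fourth moments of linear forms\<close>

lemma Pi_pmf_expectation_component:
  fixes g :: "'b \<Rightarrow> real"
  assumes "finite S" "k \<in> S"
  shows "measure_pmf.expectation (Pi_pmf S dflt p) (\<lambda>X. g (X k)) = measure_pmf.expectation (p k) g"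
proof -
  have "map_pmf (\<lambda>X. X k) (Pi_pmf S dflt p) = p k"
    using assms by (simp add: Pi_pmf_component)
  then show ?thesis by (metis integral_map_pmf)
qed

lemma Pi_pmf_expectation_linear:
  fixes p :: "'a \<Rightarrow> real pmf"
  assumes S: "finite S" and fin: "\<And>k. k \<in> S \<Longrightarrow> finite (set_pmf (p k))"
  shows "measure_pmf.expectation (Pi_pmf S dflt p) (\<lambda>X. (\<Sum>k\<in>S. a k * X k) - y)
    = (\<Sum>k\<in>S. a k * measure_pmf.expectation (p k) (\<lambda>x. x)) - y"
proof -
  have i: "integrable (measure_pmf (Pi_pmf S dflt p)) f" for f :: "_ \<Rightarrow> real"
    by (intro integrable_measure_pmf_finite finite_set_Pi_pmf S fin)
  show ?thesis
    by (simp add: i Bochner_Integration.integral_sum Pi_pmf_expectation_component[OF S, of _ _ _ "\<lambda>x. x"])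
qed

text \<open>After expanding the square, independence factors the covariance of two distinct
  coordinates into a product of centred means, so only the diagonal survives.\<close>

lemma Pi_pmf_variance_linear:
  fixes p :: "'a \<Rightarrow> real pmf"
  assumes S: "finite S" and fin: "\<And>k. k \<in> S \<Longrightarrow> finite (set_pmf (p k))"
  defines "m \<equiv> \<lambda>k. measure_pmf.expectation (p k) (\<lambda>x. x)"
  shows "measure_pmf.expectation (Pi_pmf S dflt p) (\<lambda>X. (\<Sum>k\<in>S. a k * (X k - m k))\<^sup>2)
    = (\<Sum>k\<in>S. (a k)\<^sup>2 * measure_pmf.variance (p k) (\<lambda>x. x))"
proof -
  let ?P = "Pi_pmf S dflt p"
  have i: "integrable (measure_pmf ?P) f" for f :: "_ \<Rightarrow> real"
    by (intro integrable_measure_pmf_finite finite_set_Pi_pmf S fin)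
  have E0: "measure_pmf.expectation ?P (\<lambda>X. X k - m k) = 0" if "k \<in> S" for k
    using Pi_pmf_expectation_component[OF S that, of dflt p "\<lambda>x. x - m k"]
    by (simp add: m_def integrable_measure_pmf_finite[OF fin[OF that]])
  have cov: "measure_pmf.expectation ?P (\<lambda>X. (X k - m k) * (X l - m l))
      = (if k = l then measure_pmf.variance (p k) (\<lambda>x. x) else 0)" if kl: "k \<in> S" "l \<in> S" for k l
  proof (cases "k = l")
    case True
    then show ?thesis
      using Pi_pmf_expectation_component[OF S kl(1), of dflt p "\<lambda>x. (x - m k)\<^sup>2"]
      by (simp add: m_def power2_eq_square)
  next
    case False
    have "prob_space.indep_vars ?P (\<lambda>_. borel) (\<lambda>k X. X k - m k) S"
      by (rule prob_space.indep_vars_compose2[OF measure_pmf.prob_space_axioms indep_vars_Pi_pmf[OF S]]) auto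
    then have "prob_space.indep_vars ?P (\<lambda>_. borel) (\<lambda>k X. X k - m k) {k, l}"
      by (rule prob_space.indep_vars_subset[OF measure_pmf.prob_space_axioms]) (use kl in auto)
    from prob_space.indep_vars_lebesgue_integral[OF measure_pmf.prob_space_axioms _ this] i
    have "measure_pmf.expectation ?P (\<lambda>X. \<Prod>k\<in>{k, l}. X k - m k)
        = (\<Prod>k\<in>{k, l}. measure_pmf.expectation ?P (\<lambda>X. X k - m k))"
      by blast
    then show ?thesis using False E0 kl by simp
  qed
  have "measure_pmf.expectation ?P (\<lambda>X. (\<Sum>k\<in>S. a k * (X k - m k))\<^sup>2)
      = measure_pmf.expectation ?P (\<lambda>X. \<Sum>k\<in>S. \<Sum>l\<in>S. (a k * a l) * ((X k - m k) * (X l - m l)))"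
    by (simp add: power2_eq_square sum_product mult_ac)
  also have "\<dots> = (\<Sum>k\<in>S. \<Sum>l\<in>S. (a k * a l) * measure_pmf.expectation ?P (\<lambda>X. (X k - m k) * (X l - m l)))"
    by (simp only: Bochner_Integration.integral_sum i Bochner_Integration.integral_mult_right_zero)
  also have "\<dots> = (\<Sum>k\<in>S. \<Sum>l\<in>S. if k = l then (a k)\<^sup>2 * measure_pmf.variance (p k) (\<lambda>x. x) else 0)"
    by (intro sum.cong refl) (auto simp: cov power2_eq_square)
  also have "\<dots> = (\<Sum>k\<in>S. (a k)\<^sup>2 * measure_pmf.variance (p k) (\<lambda>x. x))"
    using S by simp
  finally show ?thesis .
qed

text \<open>\<open>power4_le_exp\<close>, applied to the linear form divided by
  \<open>\<rho>\<close>, leads to the exponential moments at \<open>1/\<rho>\<close> and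
  \<open>- (1/\<rho>)\<close>. Hoeffding bounds each by \<open>exp (1/8)\<close>, hence by 2, and
  \<open>48 = 12 * (2 + 2)\<close>. The number of summands does not enter.\<close>

lemma Pi_pmf_fourth_moment_le:
  fixes p :: "'a \<Rightarrow> real pmf"
  assumes S: "finite S" and rho: "\<rho> > 0"
    and fin: "\<And>k. k \<in> S \<Longrightarrow> finite (set_pmf (p k))"
    and sub: "\<And>k. k \<in> S \<Longrightarrow> set_pmf (p k) \<subseteq> {l k..l k + \<rho>}"
    and a: "(\<Sum>k\<in>S. (a k)\<^sup>2) \<le> 1"
  shows "measure_pmf.expectation (Pi_pmf S dflt p)
      (\<lambda>X. (\<Sum>k\<in>S. a k * (X k - measure_pmf.expectation (p k) (\<lambda>x. x))) ^ 4) \<le> 48 * \<rho> ^ 4"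
proof -
  let ?P = "Pi_pmf S dflt p"
  let ?f = "\<lambda>X. \<Sum>k\<in>S. a k * (X k - measure_pmf.expectation (p k) (\<lambda>x. x))"
  have i: "integrable (measure_pmf ?P) f" for f :: "_ \<Rightarrow> real"
    by (intro integrable_measure_pmf_finite finite_set_Pi_pmf S fin)
  have exp8: "exp (1/8 :: real) \<le> 2"
    using exp_bound[of "1/8"] by (simp add: power2_eq_square)
  have b: "measure_pmf.expectation ?P (\<lambda>X. exp (t * ?f X)) \<le> 2" if t: "t\<^sup>2 * \<rho>\<^sup>2 = 1" for t
  proof -
    have "measure_pmf.expectation ?P (\<lambda>X. exp (t * ?f X)) \<le> exp (t\<^sup>2 * \<rho>\<^sup>2 * (\<Sum>k\<in>S. (a k)\<^sup>2) / 8)"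
      by (rule Pi_pmf_Hoeffding_mgf[OF S fin sub])
    also have "\<dots> \<le> exp (1/8)" using a t by simp
    finally show ?thesis using exp8 by linarith
  qed
  have pw: "(?f X) ^ 4 \<le> 12 * \<rho> ^ 4 * (exp (1/\<rho> * ?f X) + exp ((- (1/\<rho>)) * ?f X))" for X
    using power4_le_exp[of "?f X / \<rho>"] rho by (simp add: power_divide field_simps)
  have "measure_pmf.expectation ?P (\<lambda>X. (?f X) ^ 4)
      \<le> measure_pmf.expectation ?P (\<lambda>X. 12 * \<rho> ^ 4 * (exp (1/\<rho> * ?f X) + exp ((- (1/\<rho>)) * ?f X)))"
    by (intro integral_mono i pw)
  also have "\<dots> = 12 * \<rho> ^ 4 * (measure_pmf.expectation ?P (\<lambda>X. exp (1/\<rho> * ?f X))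
      + measure_pmf.expectation ?P (\<lambda>X. exp ((- (1/\<rho>)) * ?f X)))"
    by (simp only: Bochner_Integration.integral_mult_right_zero i Bochner_Integration.integral_add)
  also have "\<dots> \<le> 12 * \<rho> ^ 4 * (2 + 2)"
    using rho by (intro mult_left_mono add_mono b) (auto simp: power2_eq_square)
  finally show ?thesis by simp
qed

section \<open>The smallest singular value\<close>

lemma proots_prod_linear: "proots (\<Prod>a\<leftarrow>as. [:- a, 1:] :: 'a::idom poly) = mset as"
proof (induction as)
  case (Cons a as)
  have "(\<Prod>a\<leftarrow>as. [:- a, 1:]) \<noteq> (0 :: 'a poly)" by (auto simp: prod_list_zero_iff)
  then show ?case using Cons
    by (simp add: proots_mult del: mult_pCons_left)
qed simp

text \<open>The characteristic polynomial splits over the complex numbers. For an eigenvector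
  \<open>v\<close> of \<open>a\<close>, the Hermitian form \<open>q\<close> of \<open>M\<close> at
  \<open>v\<close> is its own conjugate and equals \<open>a\<close> times a positive real, so
  \<open>a\<close> is real. Injectivity of the embedding of polynomials then brings the
  factorization back to the reals.\<close>

lemma real_symmetric_char_poly_splits:
  fixes M :: "real mat"
  assumes M: "M \<in> carrier_mat d d" and sym: "transpose_mat M = M"
  obtains rs where "char_poly M = (\<Prod>a\<leftarrow>rs. [:- a, 1:])" "length rs = d"
proof -
  let ?C = "map_mat complex_of_real M"
  have C: "?C \<in> carrier_mat d d" using M by simp
  obtain as where as: "char_poly ?C = (\<Prod>a\<leftarrow>as. [:- a, 1:])" "length as = d"
    using char_poly_factorized[OF C] by blast
  have symM: "M $$ (i, j) = M $$ (j, i)" if "i < d" "j < d" for i j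
    using arg_cong[OF sym, of "\<lambda>N. N $$ (j, i)"] M that by simp
  have real: "a \<in> \<real>" if "a \<in> set as" for a
  proof -
    have "poly (char_poly ?C) a = 0"
      using that unfolding as by (auto simp: poly_prod_list prod_list_zero_iff)
    then have "eigenvalue ?C a" using eigenvalue_root_char_poly[OF C] by simp
    then obtain v where v: "v \<in> carrier_vec d" "v \<noteq> 0\<^sub>v d" "?C *\<^sub>v v = a \<cdot>\<^sub>v v"
      unfolding eigenvalue_def eigenvector_def using M by auto
    have row: "(\<Sum>j<d. complex_of_real (M $$ (i, j)) * v $ j) = a * v $ i" if i: "i < d" for i
    proof -
      have "(?C *\<^sub>v v) $ i = (\<Sum>j<d. complex_of_real (M $$ (i, j)) * v $ j)"
        using v(1) M i by (simp add: scalar_prod_def atLeast0LessThan)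
      then show ?thesis using v i by simp
    qed
    define q where "q = (\<Sum>i<d. cnj (v $ i) * (\<Sum>j<d. complex_of_real (M $$ (i, j)) * v $ j))"
    have "cnj q = (\<Sum>i<d. \<Sum>j<d. v $ i * (complex_of_real (M $$ (i, j)) * cnj (v $ j)))"
      by (simp add: q_def sum_distrib_left)
    also have "\<dots> = (\<Sum>j<d. \<Sum>i<d. v $ i * (complex_of_real (M $$ (i, j)) * cnj (v $ j)))"
      by (rule sum.swap)
    also have "\<dots> = q"
      unfolding q_def sum_distrib_left by (intro sum.cong refl) (simp add: symM mult_ac)
    finally have cq: "cnj q = q" .
    have "q = (\<Sum>i<d. cnj (v $ i) * (a * v $ i))"
      unfolding q_def using row by (intro sum.cong refl) auto
    also have "\<dots> = a * complex_of_real (\<Sum>i<d. (cmod (v $ i))\<^sup>2)"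
      by (simp add: sum_distrib_left complex_norm_square mult_ac del: of_real_power)
    finally have q: "q = a * complex_of_real (\<Sum>i<d. (cmod (v $ i))\<^sup>2)" .
    obtain k where "k < d" "v $ k \<noteq> 0" using v(1,2) by (metis eq_vecI carrier_vecD index_zero_vec)
    then have "(\<Sum>i<d. (cmod (v $ i))\<^sup>2) > 0" by (intro sum_pos2[of _ k]) auto
    then have "cnj a = a" using cq unfolding q by (simp del: of_real_sum)
    then show ?thesis by (simp add: Reals_cnj_iff)
  qed
  define rs where "rs = map Re as"
  have as_rs: "as = map complex_of_real rs"
    unfolding rs_def map_map o_def using real by (intro map_idI[symmetric]) auto
  interpret p: map_poly_inj_comm_ring_hom complex_of_real ..
  have "map_poly complex_of_real (char_poly M) = char_poly ?C"
    by (rule of_real_hom.char_poly_hom[OF M, symmetric])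
  also have "\<dots> = map_poly complex_of_real (\<Prod>a\<leftarrow>rs. [:- a, 1:])"
    unfolding as as_rs by (simp add: p.hom_prod_list o_def map_poly_pCons)
  finally have "char_poly M = (\<Prod>a\<leftarrow>rs. [:- a, 1:])" by simp
  then show thesis by (rule that) (simp add: rs_def as(2))
qed

text \<open>Each eigenvalue of the Gram matrix is the squared length of the image of a unit
  eigenvector, hence at least \<open>t\<^sup>2\<close>. So all members of the list of singular
  values are at least \<open>t\<close>; the list has length \<open>d\<close> because the
  characteristic polynomial splits, which makes the index \<open>d - 1\<close> valid.\<close>

lemma singular_value_min_ge:
  fixes X :: "real mat" and t :: real
  assumes X: "X \<in> carrier_mat n d" and "d \<ge> 1" and "t \<ge> 0"
    and ge: "\<And>v. (\<Sum>j<d. (v j)\<^sup>2) = 1 \<Longrightarrow> t\<^sup>2 \<le> (\<Sum>i<n. (\<Sum>j<d. v j * X $$ (i, j))\<^sup>2)"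
  shows "singular_value d X \<ge> t"
proof -
  let ?G = "transpose_mat X * X"
  have G: "?G \<in> carrier_mat d d" using X by simp
  have "transpose_mat ?G = ?G" using X by (subst transpose_mult[of _ d n _ d]) auto
  then obtain rs where rs: "char_poly ?G = (\<Prod>a\<leftarrow>rs. [:- a, 1:])" "length rs = d"
    using real_symmetric_char_poly_splits[OF G] by blast
  have ev: "t\<^sup>2 \<le> r" if "r \<in> set rs" for r
  proof -
    have "poly (char_poly ?G) r = 0"
      using that unfolding rs by (auto simp: poly_prod_list prod_list_zero_iff)
    then have "eigenvalue ?G r" using eigenvalue_root_char_poly[OF G] by simp
    then obtain v where v: "v \<in> carrier_vec d" "v \<noteq> 0\<^sub>v d" "?G *\<^sub>v v = r \<cdot>\<^sub>v v"
      unfolding eigenvalue_def eigenvector_def using X by auto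
    define s where "s = sqrt (\<Sum>j<d. (v $ j)\<^sup>2)"
    obtain k where k: "k < d" "v $ k \<noteq> 0" using v(1,2) by (metis eq_vecI carrier_vecD index_zero_vec)
    then have pos: "(\<Sum>i<d. (v $ i)\<^sup>2) > 0" by (intro sum_pos2[of _ k]) auto
    have s: "s\<^sup>2 = (\<Sum>i<d. (v $ i)\<^sup>2)" "s > 0" using pos by (auto simp: s_def)
    have Xv: "X *\<^sub>v v \<in> carrier_vec n" using X v(1) by (rule mult_mat_vec_carrier)
    have "(X *\<^sub>v v) \<bullet> (X *\<^sub>v v) = (transpose_mat X *\<^sub>v (X *\<^sub>v v)) \<bullet> v"
      by (rule transpose_vec_mult_scalar[OF X v(1) Xv, symmetric])
    also have "transpose_mat X *\<^sub>v (X *\<^sub>v v) = r \<cdot>\<^sub>v v"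
      using v X by (subst assoc_mult_mat_vec[symmetric, of _ d n _ d]) auto
    also have "(r \<cdot>\<^sub>v v) \<bullet> v = r * s\<^sup>2"
      unfolding s(1) using v(1)
      by (simp add: scalar_prod_def power2_eq_square atLeast0LessThan sum_distrib_left mult.assoc)
    finally have "r * s\<^sup>2 = (X *\<^sub>v v) \<bullet> (X *\<^sub>v v)" by simp
    also have "\<dots> = (\<Sum>i<n. ((X *\<^sub>v v) $ i)\<^sup>2)"
      unfolding scalar_prod_def power2_eq_square carrier_vecD[OF Xv] atLeast0LessThan ..
    also have "\<dots> = (\<Sum>i<n. (\<Sum>j<d. v $ j * X $$ (i, j))\<^sup>2)"
      using X v(1) by (intro sum.cong refl) (simp add: scalar_prod_def mult.commute atLeast0LessThan)
    also have "\<dots> = s\<^sup>2 * (\<Sum>i<n. (\<Sum>j<d. v $ j / s * X $$ (i, j))\<^sup>2)"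
    proof -
      have "(\<Sum>j<d. v $ j / s * X $$ (i, j)) = (\<Sum>j<d. v $ j * X $$ (i, j)) / s" for i
        by (simp add: sum_divide_distrib)
      then show ?thesis using s(2) by (simp add: power_divide sum_divide_distrib[symmetric])
    qed
    also have "\<dots> \<ge> s\<^sup>2 * t\<^sup>2"
    proof (intro mult_left_mono ge)
      show "(\<Sum>j<d. (v $ j / s)\<^sup>2) = 1"
        using s pos by (simp add: power_divide sum_divide_distrib[symmetric])
    qed auto
    finally show ?thesis using s(2) by (simp add: mult.commute)
  qed
  have sv: "singular_values X = rev (sort (map sqrt rs))"
    unfolding singular_values_def rs(1) proots_prod_linear
    by (simp only: mset_map[symmetric] sorted_list_of_multiset_mset)
  have len: "length (singular_values X) = d" by (simp add: sv rs)
  have "singular_value d X \<in> set (singular_values X)"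
    unfolding singular_value_def using len \<open>d \<ge> 1\<close> by (intro nth_mem) auto
  then obtain r where "r \<in> set rs" "singular_value d X = sqrt r" by (auto simp: sv)
  with ev show ?thesis using \<open>t \<ge> 0\<close> by (simp add: real_le_rsqrt)
qed

section \<open>The small ball estimate and the operator norm\<close>

text \<open>A matrix with independent entries is a family of independent rows. The dummy row outside
  \<open>I\<close> is the constant function \<open>c\<close>, which matches the dummy entries of the
  left side.\<close>

lemma map_pmf_curry_Pi_pmf:
  fixes p :: "'a \<times> 'b \<Rightarrow> 'c pmf"
  assumes I: "finite I" and J: "finite J"
  shows "map_pmf curry (Pi_pmf (I \<times> J) c p) = Pi_pmf I (\<lambda>_. c) (\<lambda>i. Pi_pmf J c (\<lambda>j. p (i, j)))"
proof (rule pmf_eqI)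
  fix F :: "'a \<Rightarrow> 'b \<Rightarrow> 'c"
  let ?G = "case_prod F"
  have "inj (curry :: ('a \<times> 'b \<Rightarrow> 'c) \<Rightarrow> _)" by (rule inj_on_inverseI[of _ case_prod]) simp
  from pmf_map_inj'[OF this, of "Pi_pmf (I \<times> J) c p" ?G]
  have "pmf (map_pmf curry (Pi_pmf (I \<times> J) c p)) F = pmf (Pi_pmf (I \<times> J) c p) ?G" by simp
  also have "\<dots> = pmf (Pi_pmf I (\<lambda>_. c) (\<lambda>i. Pi_pmf J c (\<lambda>j. p (i, j)))) F"
  proof (cases "\<forall>x. x \<notin> I \<times> J \<longrightarrow> ?G x = c")
    case True
    then have out: "F i j = c" if "i \<notin> I \<or> j \<notin> J" for i j using that by auto
    have "pmf (Pi_pmf I (\<lambda>_. c) (\<lambda>i. Pi_pmf J c (\<lambda>j. p (i, j)))) F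
        = (\<Prod>i\<in>I. pmf (Pi_pmf J c (\<lambda>j. p (i, j))) (F i))"
      by (rule pmf_Pi'[OF I]) (auto simp: out)
    also have "\<dots> = (\<Prod>i\<in>I. \<Prod>j\<in>J. pmf (p (i, j)) (F i j))"
      by (intro prod.cong refl pmf_Pi'[OF J]) (auto simp: out)
    also have "\<dots> = pmf (Pi_pmf (I \<times> J) c p) ?G"
    proof -
      have "pmf (Pi_pmf (I \<times> J) c p) ?G = (\<Prod>x\<in>I \<times> J. pmf (p x) (?G x))"
        using I J True by (intro pmf_Pi') blast+
      then show ?thesis by (simp add: prod.cartesian_product case_prod_unfold)
    qed
    finally show ?thesis by simp
  next
    case False
    then obtain i j where ij: "i \<notin> I \<or> j \<notin> J" "F i j \<noteq> c" by auto
    \<comment> \<open>A wrong dummy value has probability 0 either way: for \<open>i\<close> outside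
      \<open>I\<close> the whole row is wrong, and for \<open>i\<close> in \<open>I\<close> the
      factor of that row vanishes.\<close>
    have "pmf (Pi_pmf I (\<lambda>_. c) (\<lambda>i. Pi_pmf J c (\<lambda>j. p (i, j)))) F = 0"
    proof (cases "i \<in> I")
      case False
      then show ?thesis using ij by (intro pmf_Pi_outside[OF I]) (auto simp: fun_eq_iff)
    next
      case True
      then have "pmf (Pi_pmf J c (\<lambda>j. p (i, j))) (F i) = 0"
        using ij by (intro pmf_Pi_outside[OF J]) auto
      then show ?thesis using True I by (auto simp: pmf_Pi intro!: prod_zero)
    qed
    moreover have "pmf (Pi_pmf (I \<times> J) c p) ?G = 0"
      using False I J by (intro pmf_Pi_outside) auto
    ultimately show ?thesis by simp
  qed
  finally show "pmf (map_pmf curry (Pi_pmf (I \<times> J) c p)) F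
      = pmf (Pi_pmf I (\<lambda>_. c) (\<lambda>i. Pi_pmf J c (\<lambda>j. p (i, j)))) F" .
qed

text \<open>A Chernoff bound for minus the sum of squares, with the Laplace transform estimated row
  by row. Single rows may have no variance at all; only the sum of the row variances is bounded
  below, through the columns. Net points need not be unit vectors, hence the range allowed for the
  norm of \<open>x\<close>.\<close>

lemma small_ball_fixed_vector:
  fixes p :: "nat \<times> nat \<Rightarrow> real pmf" and x y :: "nat \<Rightarrow> real"
  assumes rho: "\<rho> > 0" and nu: "\<nu> > 0"
    and fin: "\<And>i j. i < n \<Longrightarrow> j < d \<Longrightarrow> finite (set_pmf (p (i, j)))"
    and sub: "\<And>i j. i < n \<Longrightarrow> j < d \<Longrightarrow> set_pmf (p (i, j)) \<subseteq> {l (i, j)..l (i, j) + \<rho>}"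
    and col: "\<And>j. j < d \<Longrightarrow> \<nu> * real n * \<rho>\<^sup>2 \<le> (\<Sum>i<n. measure_pmf.variance (p (i, j)) (\<lambda>x. x))"
    and x: "1 / 4 \<le> (\<Sum>j<d. (x j)\<^sup>2)" "(\<Sum>j<d. (x j)\<^sup>2) \<le> 1"
  shows "measure_pmf.prob (Pi_pmf ({..<n} \<times> {..<d}) 0 p)
      {X. (\<Sum>i<n. ((\<Sum>j<d. x j * X (i, j)) - y i)\<^sup>2) \<le> \<nu> / 32 * real n * \<rho>\<^sup>2}
    \<le> exp (- (\<nu>\<^sup>2 / 24576) * real n)"
proof -
  let ?P = "Pi_pmf ({..<n} \<times> {..<d}) 0 p"
  let ?Q = "\<lambda>i. Pi_pmf {..<d} 0 (\<lambda>j. p (i, j))"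
  \<comment> \<open>With \<open>h = lam * \<rho>\<^sup>2\<close>, the Laplace transform contributes
    at most \<open>- \<nu> * h / 8 + 48 * h\<^sup>2\<close> per row to the exponent;
    \<open>h = \<nu> / 768\<close> is the minimizer.\<close>
  define lam where "lam = \<nu> / (768 * \<rho>\<^sup>2)"
  have lam: "lam > 0" "lam * \<rho>\<^sup>2 = \<nu> / 768" using rho nu by (auto simp: lam_def)
  define U where "U i X = (\<Sum>j<d. x j * X j) - y i" for i and X :: "nat \<Rightarrow> real"
  define v where "v i = (\<Sum>j<d. (x j)\<^sup>2 * measure_pmf.variance (p (i, j)) (\<lambda>x. x))" for i
  have finQ: "finite (set_pmf (?Q i))" if "i < n" for i
    using fin that by (intro finite_set_Pi_pmf) auto
  have row: "measure_pmf.expectation (?Q i) (\<lambda>X. exp (- (lam * (U i X)\<^sup>2)))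
      \<le> exp (- (lam * v i - 2 * lam\<^sup>2 * (48 * \<rho> ^ 4)) / 2)" if i: "i < n" for i
  proof (rule expectation_exp_neg_square_le[OF finQ[OF i] _ refl])
    let ?m = "\<lambda>j. measure_pmf.expectation (p (i, j)) (\<lambda>x. x)"
    have EU: "measure_pmf.expectation (?Q i) (U i) = (\<Sum>j<d. x j * ?m j) - y i"
      unfolding U_def using fin i by (intro Pi_pmf_expectation_linear) auto
    have UE: "U i X - measure_pmf.expectation (?Q i) (U i) = (\<Sum>j<d. x j * (X j - ?m j))" for X
      unfolding EU by (simp add: U_def right_diff_distrib sum_subtractf)
    show "measure_pmf.expectation (?Q i) (\<lambda>X. (U i X - measure_pmf.expectation (?Q i) (U i))\<^sup>2) = v i"
      unfolding UE v_def using fin i by (intro Pi_pmf_variance_linear) auto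
    show "measure_pmf.expectation (?Q i) (\<lambda>X. (U i X - measure_pmf.expectation (?Q i) (U i)) ^ 4)
        \<le> 48 * \<rho> ^ 4"
      unfolding UE using fin sub i x rho
      by (intro Pi_pmf_fourth_moment_le[where l = "\<lambda>j. l (i, j)"]) auto
  qed (use lam in simp)
  \<comment> \<open>Interchanging the sums turns row variances into column variances, weighted by
    the \<open>(x j)\<^sup>2\<close>.\<close>
  have "(\<Sum>i<n. v i) = (\<Sum>j<d. (x j)\<^sup>2 * (\<Sum>i<n. measure_pmf.variance (p (i, j)) (\<lambda>x. x)))"
    unfolding v_def sum_distrib_left by (rule sum.swap)
  also have "\<dots> \<ge> (\<Sum>j<d. (x j)\<^sup>2 * (\<nu> * real n * \<rho>\<^sup>2))"
    by (intro sum_mono mult_left_mono col) auto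
  also have "(\<Sum>j<d. (x j)\<^sup>2 * (\<nu> * real n * \<rho>\<^sup>2)) = (\<Sum>j<d. (x j)\<^sup>2) * (\<nu> * real n * \<rho>\<^sup>2)"
    by (simp add: sum_distrib_right)
  also have "\<dots> \<ge> 1 / 4 * (\<nu> * real n * \<rho>\<^sup>2)"
    using x nu by (intro mult_right_mono) auto
  finally have vsum: "1 / 4 * (\<nu> * real n * \<rho>\<^sup>2) \<le> (\<Sum>i<n. v i)" .
  have "measure_pmf.expectation ?P (\<lambda>X. \<Prod>i<n. exp (- (lam * (U i (curry X i))\<^sup>2)))
      = measure_pmf.expectation (map_pmf curry ?P) (\<lambda>F. \<Prod>i<n. exp (- (lam * (U i (F i))\<^sup>2)))"
    by simp
  also have "\<dots> = (\<Prod>i<n. measure_pmf.expectation (?Q i) (\<lambda>X. exp (- (lam * (U i X)\<^sup>2))))"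
    unfolding map_pmf_curry_Pi_pmf[OF finite_lessThan finite_lessThan]
    by (rule expectation_prod_Pi_pmf) (auto intro: integrable_measure_pmf_finite finQ)
  also have "\<dots> \<le> (\<Prod>i<n. exp (- (lam * v i - 2 * lam\<^sup>2 * (48 * \<rho> ^ 4)) / 2))"
    by (intro prod_mono conjI row Bochner_Integration.integral_nonneg) auto
  also have "\<dots> = exp (\<Sum>i<n. - (lam * v i - 2 * lam\<^sup>2 * (48 * \<rho> ^ 4)) / 2)"
    by (rule exp_sum[symmetric]) simp
  also have "(\<Sum>i<n. - (lam * v i - 2 * lam\<^sup>2 * (48 * \<rho> ^ 4)) / 2)
      = - (lam * (\<Sum>i<n. v i)) / 2 + real n * (48 * (lam * \<rho>\<^sup>2)\<^sup>2)"
    by (simp add: sum_distrib_left diff_divide_distrib sum_subtractf sum_negf sum_divide_distrib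
        power_mult_distrib flip: power_mult)
  finally have L: "measure_pmf.expectation ?P (\<lambda>X. \<Prod>i<n. exp (- (lam * (U i (curry X i))\<^sup>2)))
      \<le> exp (- (lam * (\<Sum>i<n. v i)) / 2 + real n * (48 * (lam * \<rho>\<^sup>2)\<^sup>2))" .
  let ?T = "lam * (\<nu> / 32 * real n * \<rho>\<^sup>2)"
  have "measure_pmf.prob ?P {X. (\<Sum>i<n. ((\<Sum>j<d. x j * X (i, j)) - y i)\<^sup>2) \<le> \<nu> / 32 * real n * \<rho>\<^sup>2}
      = measure_pmf.prob ?P {X. - ?T \<le> (\<Sum>i<n. - (lam * (U i (curry X i))\<^sup>2))}"
  proof -
    have "(\<Sum>i<n. - (lam * (U i (curry X i))\<^sup>2)) = - (lam * (\<Sum>i<n. (U i (curry X i))\<^sup>2))" for X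
      by (simp add: sum_negf sum_distrib_left)
    then show ?thesis
      by (simp only: neg_le_iff_le mult_le_cancel_left_pos[OF lam(1)]) (simp add: U_def)
  qed
  also have "\<dots> \<le> exp (- (- ?T)) * measure_pmf.expectation ?P
      (\<lambda>X. exp (\<Sum>i<n. - (lam * (U i (curry X i))\<^sup>2)))"
    using fin by (intro pmf_Chernoff finite_set_Pi_pmf) auto
  also have "\<dots> \<le> exp ?T * exp (- (lam * (\<Sum>i<n. v i)) / 2 + real n * (48 * (lam * \<rho>\<^sup>2)\<^sup>2))"
    using L by (simp add: exp_sum)
  also have "\<dots> = exp (?T - (lam * (\<Sum>i<n. v i)) / 2 + real n * (48 * (lam * \<rho>\<^sup>2)\<^sup>2))"
    by (simp add: exp_add[symmetric] algebra_simps)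
  also have "\<dots> \<le> exp (- (\<nu>\<^sup>2 / 24576) * real n)"
  proof -
    define q where "q = \<nu>\<^sup>2 * real n"
    have "?T = (lam * \<rho>\<^sup>2) * (\<nu> * real n) / 32" by simp
    then have T: "?T = q / 24576" unfolding lam(2) q_def by (simp add: power2_eq_square)
    have S: "real n * (48 * (lam * \<rho>\<^sup>2)\<^sup>2) = q / 12288"
      unfolding lam(2) q_def by (simp add: power2_eq_square)
    have "(lam * \<rho>\<^sup>2) * (\<nu> * real n) / 4 = lam * (1 / 4 * (\<nu> * real n * \<rho>\<^sup>2))" by simp
    also have "\<dots> \<le> lam * (\<Sum>i<n. v i)"
      using vsum lam by (intro mult_left_mono) auto
    finally have "q / 3072 \<le> lam * (\<Sum>i<n. v i)"
      unfolding lam(2) q_def by (simp add: power2_eq_square)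
    \<comment> \<open>In units of \<open>q / 24576\<close> the three terms are 1 for the threshold,
      at most -4 for the variance and 2 for the fourth moment.\<close>
    then have "q / 24576 - lam * (\<Sum>i<n. v i) / 2 + q / 12288 \<le> - (q / 24576)" by argo
    then show ?thesis unfolding T S by (simp add: q_def)
  qed
  finally show ?thesis .
qed

section \<open>Operator norm of the rounding error\<close>

lemma L2_set_abs: "L2_set (\<lambda>i. \<bar>f i\<bar>) A = L2_set f A"
  by (simp add: L2_set_def)

text \<open>Let \<open>Sup Z\<close> be the supremum of the bilinear form \<open>B\<close> over
  pairs of balls. Moving both arguments to net points costs \<open>Sup Z / 4\<close> each, so
  \<open>Sup Z \<le> m + Sup Z / 2\<close>. The approximants have to lie in the ball because the
  error terms are again compared with \<open>Sup Z\<close>.\<close>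

lemma operator_norm_le_net:
  fixes E :: "nat \<times> nat \<Rightarrow> real"
  assumes Nx: "\<And>x. L2_set x {..<d} \<le> 1 \<Longrightarrow> \<exists>x'\<in>Nx. L2_set x' {..<d} \<le> 1 \<and> L2_set (\<lambda>j. x j - x' j) {..<d} \<le> 1 / 4"
    and Ny: "\<And>y. L2_set y {..<n} \<le> 1 \<Longrightarrow> \<exists>y'\<in>Ny. L2_set y' {..<n} \<le> 1 \<and> L2_set (\<lambda>i. y i - y' i) {..<n} \<le> 1 / 4"
    and m: "\<And>x y. x \<in> Nx \<Longrightarrow> y \<in> Ny \<Longrightarrow> (\<Sum>i<n. y i * (\<Sum>j<d. x j * E (i, j))) \<le> m"
    and x: "L2_set x {..<d} \<le> 1"
  shows "L2_set (\<lambda>i. \<Sum>j<d. x j * E (i, j)) {..<n} \<le> 2 * m"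
proof -
  define B where "B x y = (\<Sum>i<n. y i * (\<Sum>j<d. x j * E (i, j)))" for x y
  define Z where "Z = {B x y | x y. L2_set x {..<d} \<le> 1 \<and> L2_set y {..<n} \<le> 1}"
  have coord: "\<bar>f i\<bar> \<le> 1" if "L2_set f {..<k} \<le> 1" "i < k" for f :: "nat \<Rightarrow> real" and i k
  proof -
    have "\<bar>f i\<bar> \<le> L2_set (\<lambda>i. \<bar>f i\<bar>) {..<k}" using that by (intro member_le_L2_set) auto
    then show ?thesis using that by (simp add: L2_set_abs)
  qed
  \<comment> \<open>A crude bound suffices: it only makes the supremum finite, so that it can be
    absorbed later.\<close>
  have bdd: "bdd_above Z"
  proof (rule bdd_aboveI[of _ "\<Sum>i<n. \<Sum>j<d. \<bar>E (i, j)\<bar>"])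
    fix z assume "z \<in> Z"
    then obtain x y where z: "z = B x y" "L2_set x {..<d} \<le> 1" "L2_set y {..<n} \<le> 1"
      unfolding Z_def by blast
    have "z = (\<Sum>i<n. \<Sum>j<d. (y i * x j) * E (i, j))"
      by (simp add: z B_def sum_distrib_left mult.assoc)
    also have "\<dots> \<le> (\<Sum>i<n. \<Sum>j<d. 1 * \<bar>E (i, j)\<bar>)"
    proof (intro sum_mono)
      fix i j assume "i \<in> {..<n}" "j \<in> {..<d}"
      then have "\<bar>y i\<bar> * \<bar>x j\<bar> \<le> 1 * 1"
        using coord[OF z(2)] coord[OF z(3)] by (intro mult_mono) auto
      then have "\<bar>y i * x j\<bar> * \<bar>E (i, j)\<bar> \<le> 1 * \<bar>E (i, j)\<bar>"
        by (intro mult_right_mono) (auto simp: abs_mult)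
      then show "y i * x j * E (i, j) \<le> 1 * \<bar>E (i, j)\<bar>"
        using abs_ge_self[of "y i * x j * E (i, j)"] by (simp add: abs_mult)
    qed
    finally show "z \<le> (\<Sum>i<n. \<Sum>j<d. \<bar>E (i, j)\<bar>)" by simp
  qed
  have up: "B x y \<le> Sup Z" if "L2_set x {..<d} \<le> 1" "L2_set y {..<n} \<le> 1" for x y
    using that by (intro cSup_upper bdd) (auto simp: Z_def)
  have scale_x: "B (\<lambda>j. c * x j) y = c * B x y" and scale_y: "B x (\<lambda>i. c * y i) = c * B x y" for c x y
    unfolding B_def by (simp_all add: sum_distrib_left mult_ac)
  have split: "B x y = B x' y' + B x' (\<lambda>i. y i - y' i) + B (\<lambda>j. x j - x' j) y" for x y x' y'
    unfolding B_def by (simp add: algebra_simps sum_subtractf sum.distrib)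
  have half: "B x y \<le> m + Sup Z / 2" if x: "L2_set x {..<d} \<le> 1" and y: "L2_set y {..<n} \<le> 1" for x y
  proof -
    obtain x' where x': "x' \<in> Nx" "L2_set x' {..<d} \<le> 1" "L2_set (\<lambda>j. x j - x' j) {..<d} \<le> 1 / 4"
      using Nx[OF x] by blast
    obtain y' where y': "y' \<in> Ny" "L2_set y' {..<n} \<le> 1" "L2_set (\<lambda>i. y i - y' i) {..<n} \<le> 1 / 4"
      using Ny[OF y] by blast
    have "L2_set (\<lambda>i. 4 * (y i - y' i)) {..<n} \<le> 1" "L2_set (\<lambda>j. 4 * (x j - x' j)) {..<d} \<le> 1"
      unfolding L2_set_scale using x'(3) y'(3) by simp_all
    from up[OF x'(2) this(1)] up[OF this(2) y]
    have "4 * B x' (\<lambda>i. y i - y' i) \<le> Sup Z" "4 * B (\<lambda>j. x j - x' j) y \<le> Sup Z"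
      unfolding scale_y scale_x by blast+
    moreover have "B x' y' \<le> m" unfolding B_def by (rule m[OF x'(1) y'(1)])
    ultimately show ?thesis using split[of x y x' y'] by linarith
  qed
  have "B (\<lambda>_. 0) (\<lambda>_. 0) \<in> Z" unfolding Z_def by (intro CollectI exI conjI refl) (auto simp: L2_set_def)
  then have "Sup Z \<le> m + Sup Z / 2" using half by (intro cSup_least) (auto simp: Z_def)
  then have sup: "Sup Z \<le> 2 * m" by linarith
  define w where "w i = (\<Sum>j<d. x j * E (i, j))" for i
  have "L2_set w {..<n} \<le> Sup Z"
  proof (cases "L2_set w {..<n} = 0")
    case True
    have "B x (\<lambda>_. 0) \<le> Sup Z" using x by (intro up) (auto simp: L2_set_def)
    then show ?thesis using True by (simp add: B_def)
  next
    case False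
    \<comment> \<open>The norm of \<open>w\<close> is attained by pairing it with its own
      normalization.\<close>
    let ?c = "1 / L2_set w {..<n}"
    have "?c * (L2_set w {..<n})\<^sup>2 = B x (\<lambda>i. ?c * w i)"
      unfolding scale_y L2_set_power2 B_def w_def[symmetric] by (simp add: power2_eq_square)
    also have "\<dots> \<le> Sup Z"
    proof (rule up[OF x])
      show "L2_set (\<lambda>i. ?c * w i) {..<n} \<le> 1"
        unfolding L2_set_scale using False by simp
    qed
    finally show ?thesis using False by (simp add: power2_eq_square)
  qed
  then show ?thesis using sup unfolding w_def by linarith
qed

text \<open>A union bound over at most \<open>K ^ n * K ^ n\<close> pairs of net points. For each
  pair the bilinear form is a linear form in the entries with weights \<open>y i * x j\<close>,
  whose squares sum to at most 1, so Hoeffding's tail bound applies.\<close>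

lemma operator_norm_tail:
  obtains C where "C > 0"
    "\<And>n d \<rho> l (p :: nat \<times> nat \<Rightarrow> real pmf). \<lbrakk>d \<le> n; \<rho> > 0;
      \<And>k. k \<in> {..<n} \<times> {..<d} \<Longrightarrow> finite (set_pmf (p k));
      \<And>k. k \<in> {..<n} \<times> {..<d} \<Longrightarrow> set_pmf (p k) \<subseteq> {l k..l k + \<rho>}\<rbrakk> \<Longrightarrow>
      measure_pmf.prob (Pi_pmf ({..<n} \<times> {..<d}) 0 p)
        {X. \<exists>x. L2_set x {..<d} \<le> 1 \<and> C * \<rho> * sqrt (real n) <
          L2_set (\<lambda>i. \<Sum>j<d. x j * (X (i, j) - measure_pmf.expectation (p (i, j)) (\<lambda>x. x))) {..<n}}
      \<le> exp (- real n)"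
proof -
  obtain K where K: "K \<ge> 1" and net: "\<And>d. \<exists>N :: (nat \<Rightarrow> real) set. finite N \<and> real (card N) \<le> K ^ d \<and>
    (\<forall>y\<in>N. L2_set y {..<d} \<le> 1) \<and>
    (\<forall>x. L2_set x {..<d} \<le> 1 \<longrightarrow> (\<exists>y\<in>N. L2_set (\<lambda>i. x i - y i) {..<d} \<le> 1 / 4))"
    using ball_net[of "1 / 4"] by auto
  \<comment> \<open>With this \<open>C\<close> the Hoeffding exponent is
    \<open>2 * n * (1 + ln K)\<close>: the part with \<open>ln K\<close> pays for the number of
    pairs.\<close>
  define C where "C = 2 * sqrt (1 + ln K)"
  have "0 < 1 + ln K" using ln_ge_zero[OF K] by linarith
  then have C: "C > 0" "C\<^sup>2 = 4 * (1 + ln K)" by (auto simp: C_def power_mult_distrib)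
  show thesis
  proof (rule that[OF C(1)])
    fix n d :: nat and \<rho> :: real and l and p :: "nat \<times> nat \<Rightarrow> real pmf"
    assume dn: "d \<le> n" and rho: "\<rho> > 0"
      and p: "\<And>k. k \<in> {..<n} \<times> {..<d} \<Longrightarrow> finite (set_pmf (p k))"
        "\<And>k. k \<in> {..<n} \<times> {..<d} \<Longrightarrow> set_pmf (p k) \<subseteq> {l k..l k + \<rho>}"
    let ?S = "{..<n} \<times> {..<d}"
    let ?P = "Pi_pmf ?S 0 p"
    define m where "m k = measure_pmf.expectation (p k) (\<lambda>x. x)" for k
    \<comment> \<open>Half of the target norm, since passing from the nets to the balls doubles the
      bound.\<close>
    define t where "t = C * \<rho> * sqrt (real n) / 2"
    obtain Nx where Nx: "finite Nx" "real (card Nx) \<le> K ^ d" "\<forall>y\<in>Nx. L2_set y {..<d} \<le> 1"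
      "\<And>x. L2_set x {..<d} \<le> 1 \<Longrightarrow> \<exists>y\<in>Nx. L2_set (\<lambda>i. x i - y i) {..<d} \<le> 1 / 4"
      using net[of d] by blast
    obtain Ny where Ny: "finite Ny" "real (card Ny) \<le> K ^ n" "\<forall>y\<in>Ny. L2_set y {..<n} \<le> 1"
      "\<And>x. L2_set x {..<n} \<le> 1 \<Longrightarrow> \<exists>y\<in>Ny. L2_set (\<lambda>i. x i - y i) {..<n} \<le> 1 / 4"
      using net[of n] by blast
    define Ev where "Ev = (\<lambda>(x, y). {X. t \<le> (\<Sum>k\<in>?S. (y (fst k) * x (snd k)) * (X k - m k))})"
    have t: "t \<ge> 0" using C rho by (simp add: t_def)
    have Ev: "measure_pmf.prob ?P (Ev z) \<le> exp (- 2 * t\<^sup>2 / \<rho>\<^sup>2)" if z: "z \<in> Nx \<times> Ny" for z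
    proof -
      obtain x y where xy: "z = (x, y)" "x \<in> Nx" "y \<in> Ny" using z by blast
      have "(\<Sum>k\<in>?S. (y (fst k) * x (snd k))\<^sup>2) = (\<Sum>i<n. \<Sum>j<d. (y i)\<^sup>2 * (x j)\<^sup>2)"
        by (simp add: sum.cartesian_product power_mult_distrib case_prod_unfold)
      also have "\<dots> = (\<Sum>i<n. (y i)\<^sup>2) * (\<Sum>j<d. (x j)\<^sup>2)" by (simp only: sum_product)
      also have "\<dots> \<le> 1 * 1"
      proof (intro mult_mono)
        show "(\<Sum>i<n. (y i)\<^sup>2) \<le> 1" "(\<Sum>j<d. (x j)\<^sup>2) \<le> 1"
          using Nx(3) Ny(3) xy L2_set_le_iff[of 1 x "{..<d}"] L2_set_le_iff[of 1 y "{..<n}"] by auto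
      qed (auto intro: sum_nonneg)
      finally have "(\<Sum>k\<in>?S. (y (fst k) * x (snd k))\<^sup>2) \<le> 1" by simp
      then show ?thesis
        unfolding Ev_def xy(1) prod.case m_def
        using p rho t by (intro Pi_pmf_Hoeffding_tail[where l = l]) blast+
    qed
    have "{X. \<exists>x. L2_set x {..<d} \<le> 1 \<and> C * \<rho> * sqrt (real n) <
        L2_set (\<lambda>i. \<Sum>j<d. x j * (X (i, j) - m (i, j))) {..<n}} \<subseteq> (\<Union>z\<in>Nx \<times> Ny. Ev z)"
    proof (rule subsetI, rule ccontr)
      fix X
      assume "X \<in> {X. \<exists>x. L2_set x {..<d} \<le> 1 \<and> C * \<rho> * sqrt (real n) <
        L2_set (\<lambda>i. \<Sum>j<d. x j * (X (i, j) - m (i, j))) {..<n}}"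
      then obtain x where x: "L2_set x {..<d} \<le> 1"
        "2 * t < L2_set (\<lambda>i. \<Sum>j<d. x j * (X (i, j) - m (i, j))) {..<n}"
        by (auto simp: t_def)
      assume nin: "X \<notin> (\<Union>z\<in>Nx \<times> Ny. Ev z)"
      have "L2_set (\<lambda>i. \<Sum>j<d. x j * (\<lambda>k. X k - m k) (i, j)) {..<n} \<le> 2 * t"
      proof (rule operator_norm_le_net[OF _ _ _ x(1)])
        show "\<exists>x'\<in>Nx. L2_set x' {..<d} \<le> 1 \<and> L2_set (\<lambda>j. x j - x' j) {..<d} \<le> 1 / 4"
          if "L2_set x {..<d} \<le> 1" for x using Nx(3,4) that by blast
        show "\<exists>y'\<in>Ny. L2_set y' {..<n} \<le> 1 \<and> L2_set (\<lambda>i. y i - y' i) {..<n} \<le> 1 / 4"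
          if "L2_set y {..<n} \<le> 1" for y using Ny(3,4) that by blast
        show "(\<Sum>i<n. y i * (\<Sum>j<d. x j * (X (i, j) - m (i, j)))) \<le> t"
          if "x \<in> Nx" "y \<in> Ny" for x y
        proof -
          have "X \<notin> Ev (x, y)" using nin that by blast
          moreover have "(\<Sum>i<n. y i * (\<Sum>j<d. x j * (X (i, j) - m (i, j))))
              = (\<Sum>k\<in>?S. (y (fst k) * x (snd k)) * (X k - m k))"
            by (simp add: sum_distrib_left sum.cartesian_product case_prod_unfold mult.assoc)
          ultimately show ?thesis by (simp add: Ev_def)
        qed
      qed
      then show False using x(2) by simp
    qed
    then have "measure_pmf.prob ?P {X. \<exists>x. L2_set x {..<d} \<le> 1 \<and> C * \<rho> * sqrt (real n) <
        L2_set (\<lambda>i. \<Sum>j<d. x j * (X (i, j) - m (i, j))) {..<n}}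
      \<le> measure_pmf.prob ?P (\<Union>z\<in>Nx \<times> Ny. Ev z)"
      by (intro measure_pmf.finite_measure_mono) auto
    also have "\<dots> \<le> (\<Sum>z\<in>Nx \<times> Ny. measure_pmf.prob ?P (Ev z))"
      using Nx(1) Ny(1) by (intro measure_pmf.finite_measure_subadditive_finite) auto
    also have "\<dots> \<le> real (card (Nx \<times> Ny)) * exp (- 2 * t\<^sup>2 / \<rho>\<^sup>2)"
      by (intro sum_bounded_above Ev)
    also have "\<dots> \<le> (K ^ n * K ^ n) * exp (- 2 * t\<^sup>2 / \<rho>\<^sup>2)"
    proof (intro mult_right_mono)
      have "real (card Nx) * real (card Ny) \<le> K ^ n * K ^ n"
        using Nx(2) Ny(2) K power_increasing[OF dn K] by (intro mult_mono) auto
      then show "real (card (Nx \<times> Ny)) \<le> K ^ n * K ^ n" by (simp add: card_cartesian_product)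
    qed simp
    also have "K ^ n = exp (real n * ln K)" using K by (simp add: exp_of_nat_mult)
    also have "- 2 * t\<^sup>2 / \<rho>\<^sup>2 = - 2 * real n * (1 + ln K)"
      using rho by (simp add: t_def power_divide power_mult_distrib C(2))
    also have "exp (real n * ln K) * exp (real n * ln K) * exp (- 2 * real n * (1 + ln K)) = exp (- 2 * real n)"
      by (simp add: exp_add[symmetric] algebra_simps)
    also have "\<dots> \<le> exp (- real n)" by simp
    finally show "measure_pmf.prob ?P {X. \<exists>x. L2_set x {..<d} \<le> 1 \<and> C * \<rho> * sqrt (real n) <
        L2_set (\<lambda>i. \<Sum>j<d. x j * (X (i, j) - measure_pmf.expectation (p (i, j)) (\<lambda>x. x))) {..<n}}
      \<le> exp (- real n)" unfolding m_def .
  qed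
qed

section \<open>Deterministic passage from nets to all unit vectors\<close>

lemma L2_set_diff_le: "L2_set (\<lambda>i. f i - g i) A \<le> L2_set f A + L2_set g A"
  using L2_set_triangle_ineq[of f "\<lambda>i. - g i" A] by (simp add: L2_set_def)

text \<open>If \<open>X x\<close> were short, \<open>A x\<close> would have norm at most
  \<open>2 * C * s\<close>, so its coordinates, scaled by that radius, lie in the unit ball and are
  approximated by some \<open>z\<close>. One net \<open>N\<close> serves for both \<open>x\<close>
  and \<open>z\<close>, as both live in dimension \<open>d\<close>. In \<open>big\<close> the shift
  contains \<open>A x\<close>, so what is bounded below is the error applied to \<open>x\<close>
  plus a vector of the range.\<close>

lemma L2_set_lower_bound_by_nets:
  fixes X A :: "nat \<times> nat \<Rightarrow> real" and u :: "nat \<Rightarrow> nat \<Rightarrow> real"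
  assumes s: "s > 0" and C: "C > 0" and c: "c \<le> C" "c + 3 * C * \<epsilon> \<le> b" and eps: "0 < \<epsilon>" "\<epsilon> \<le> 1 / 2"
    and op: "\<And>x. L2_set x {..<d} \<le> 1 \<Longrightarrow> L2_set (\<lambda>i. \<Sum>j<d. x j * (X (i, j) - A (i, j))) {..<n} \<le> C * s"
    and net: "\<And>x. L2_set x {..<d} \<le> 1 \<Longrightarrow> \<exists>y\<in>N. L2_set (\<lambda>j. x j - y j) {..<d} \<le> \<epsilon>"
    and u1: "\<And>c. L2_set (\<lambda>i. \<Sum>k<d. c k * u k i) {..<n} \<le> L2_set c {..<d}"
    and u2: "\<And>x. \<exists>c. L2_set c {..<d} = L2_set (\<lambda>i. \<Sum>j<d. x j * A (i, j)) {..<n} \<and>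
           (\<forall>i<n. (\<Sum>j<d. x j * A (i, j)) = (\<Sum>k<d. c k * u k i))"
    and big: "\<And>x z. x \<in> N \<Longrightarrow> z \<in> N \<Longrightarrow> 1 / 2 \<le> L2_set x {..<d} \<Longrightarrow>
        b * s < L2_set (\<lambda>i. (\<Sum>j<d. x j * X (i, j)) -
          ((\<Sum>j<d. x j * A (i, j)) - 2 * C * s * (\<Sum>k<d. z k * u k i))) {..<n}"
    and x: "L2_set x {..<d} = 1"
  shows "c * s \<le> L2_set (\<lambda>i. \<Sum>j<d. x j * X (i, j)) {..<n}"
proof (rule ccontr)
  assume "\<not> ?thesis"
  then have small: "L2_set (\<lambda>i. \<Sum>j<d. x j * X (i, j)) {..<n} < c * s" by simp
  define D where "D = 2 * C * s"
  have D: "D > 0" using C s by (simp add: D_def)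
  obtain a where a: "L2_set a {..<d} = L2_set (\<lambda>i. \<Sum>j<d. x j * A (i, j)) {..<n}"
    "\<And>i. i < n \<Longrightarrow> (\<Sum>j<d. x j * A (i, j)) = (\<Sum>k<d. a k * u k i)"
    using u2[of x] by blast
  have "L2_set (\<lambda>i. \<Sum>j<d. x j * A (i, j)) {..<n}
      = L2_set (\<lambda>i. (\<Sum>j<d. x j * X (i, j)) - (\<Sum>j<d. x j * (X (i, j) - A (i, j)))) {..<n}"
    by (simp add: right_diff_distrib sum_subtractf)
  also have "\<dots> \<le> c * s + C * s"
    using small op[of x] x by (intro order.trans[OF L2_set_diff_le]) simp
  also have "\<dots> \<le> D" using c s by (simp add: D_def algebra_simps)
  finally have aD: "L2_set a {..<d} \<le> D" by (simp add: a(1))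
  have "L2_set (\<lambda>k. 1 / D * a k) {..<d} \<le> 1"
    unfolding L2_set_scale using aD D by simp
  then obtain z where z: "z \<in> N" "L2_set (\<lambda>k. 1 / D * a k - z k) {..<d} \<le> \<epsilon>"
    using net[of "\<lambda>k. 1 / D * a k"] by blast
  obtain x' where x': "x' \<in> N" "L2_set (\<lambda>j. x j - x' j) {..<d} \<le> \<epsilon>"
    using net[of x] x by auto
  have "1 \<le> L2_set (\<lambda>j. x j - x' j) {..<d} + L2_set x' {..<d}"
    using L2_set_triangle_ineq[of "\<lambda>j. x j - x' j" x' "{..<d}"] x by simp
  \<comment> \<open>This is why \<open>\<epsilon> \<le> 1 / 2\<close> is assumed and why
    \<open>big\<close> may be restricted to vectors of norm at least \<open>1 / 2\<close>.\<close>
  then have half: "1 / 2 \<le> L2_set x' {..<d}" using x'(2) eps by linarith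
  have E: "L2_set (\<lambda>i. \<Sum>j<d. (x j - x' j) * (X (i, j) - A (i, j))) {..<n} \<le> \<epsilon> * (C * s)"
  proof -
    have "L2_set (\<lambda>j. 1 / \<epsilon> * (x j - x' j)) {..<d} \<le> 1"
      unfolding L2_set_scale using x'(2) eps by simp
    from op[OF this] have "L2_set (\<lambda>i. 1 / \<epsilon> * (\<Sum>j<d. (x j - x' j) * (X (i, j) - A (i, j)))) {..<n} \<le> C * s"
      by (simp add: sum_distrib_left mult.assoc)
    then show ?thesis unfolding L2_set_scale using eps by (simp add: field_simps)
  qed
  have W: "L2_set (\<lambda>i. \<Sum>k<d. (a k - D * z k) * u k i) {..<n} \<le> \<epsilon> * D"
  proof -
    have "L2_set (\<lambda>k. a k - D * z k) {..<d} = L2_set (\<lambda>k. D * (1 / D * a k - z k)) {..<d}"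
      using D by (simp add: right_diff_distrib)
    also have "\<dots> = D * L2_set (\<lambda>k. 1 / D * a k - z k) {..<d}"
      unfolding L2_set_scale using D by simp
    also have "\<dots> \<le> D * \<epsilon>" using z(2) D by (intro mult_left_mono) auto
    finally show ?thesis using u1[of "\<lambda>k. a k - D * z k"] by (simp add: mult.commute)
  qed
  \<comment> \<open>Both sides equal the row \<open>i\<close> of the error applied to
    \<open>x'\<close>, plus \<open>D\<close> times the combination of the \<open>u k\<close> with
    coefficients \<open>z k\<close>.\<close>
  have "(\<Sum>j<d. x' j * X (i, j)) - ((\<Sum>j<d. x' j * A (i, j)) - D * (\<Sum>k<d. z k * u k i))
      = (\<Sum>j<d. x j * X (i, j)) - (\<Sum>j<d. (x j - x' j) * (X (i, j) - A (i, j)))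
        - (\<Sum>k<d. (a k - D * z k) * u k i)" if "i < n" for i
    using a(2)[OF that]
    by (simp add: algebra_simps sum_subtractf sum.distrib sum_distrib_left)
  then have "L2_set (\<lambda>i. (\<Sum>j<d. x' j * X (i, j)) - ((\<Sum>j<d. x' j * A (i, j)) - D * (\<Sum>k<d. z k * u k i))) {..<n}
      = L2_set (\<lambda>i. (\<Sum>j<d. x j * X (i, j)) - (\<Sum>j<d. (x j - x' j) * (X (i, j) - A (i, j)))
        - (\<Sum>k<d. (a k - D * z k) * u k i)) {..<n}"
    by (intro L2_set_cong) auto
  also have "\<dots> \<le> L2_set (\<lambda>i. \<Sum>j<d. x j * X (i, j)) {..<n}
      + L2_set (\<lambda>i. \<Sum>j<d. (x j - x' j) * (X (i, j) - A (i, j))) {..<n}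
      + L2_set (\<lambda>i. \<Sum>k<d. (a k - D * z k) * u k i) {..<n}"
    by (intro order.trans[OF L2_set_diff_le] add_right_mono L2_set_diff_le)
  also have "\<dots> \<le> c * s + \<epsilon> * (C * s) + \<epsilon> * D"
    using small E W by linarith
  \<comment> \<open>One \<open>C * \<epsilon>\<close> comes from approximating \<open>x\<close> and
    two from approximating the coordinates, whose ball has radius \<open>2 * C * s\<close>.\<close>
  also have "\<dots> = (c + 3 * C * \<epsilon>) * s" by (simp add: D_def algebra_simps)
  also have "\<dots> \<le> b * s" using c s by (intro mult_right_mono) auto
  finally show False using big[OF x'(1) z(1) half] unfolding D_def by linarith
qed

section \<open>Stochastic rounding\<close>

text \<open>In any cell containing \<open>x\<close> the rounding is a two-point law on the cell's
  ends, with the upper end taken with probability \<open>q\<close>. Its support has the width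
  Hoeffding's lemma expects, and its mean is \<open>g + q * resolution R B\<close>.\<close>

lemma stoch_round_support_mean:
  assumes "R > 0" "B \<ge> 1" "\<bar>x\<bar> \<le> R"
  shows "finite (set_pmf (stoch_round R B x))"
    and "\<exists>g. set_pmf (stoch_round R B x) \<subseteq> {g..g + resolution R B}"
    and "measure_pmf.expectation (stoch_round R B x) (\<lambda>x. x) = x"
proof -
  obtain k where k: "in_cell R B k x" using ex_cell[OF assms] by blast
  have pos: "resolution R B > 0" using assms resolution_pos by blast
  define g where "g = grid_point R B k"
  define q where "q = (x - g) / resolution R B"
  have q: "0 \<le> q" "q \<le> 1"
    using k pos by (auto simp: in_cell_def grid_point_Suc[of R B k, simplified] q_def g_def)
  have eq: "stoch_round R B x = map_pmf (\<lambda>up. if up then g + resolution R B else g) (bernoulli_pmf q)"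
    unfolding stoch_round_eq[OF assms(1,2) k] cell_round_def grid_point_Suc g_def q_def ..
  show "finite (set_pmf (stoch_round R B x))" unfolding eq by simp
  show "\<exists>g. set_pmf (stoch_round R B x) \<subseteq> {g..g + resolution R B}"
    unfolding eq using pos by (intro exI[of _ g]) auto
  have "measure_pmf.expectation (stoch_round R B x) (\<lambda>x. x) = (g + resolution R B) * q + g * (1 - q)"
    unfolding eq integral_map_pmf using q by (subst integral_bernoulli_pmf) auto
  also have "\<dots> = g + q * resolution R B" by (simp add: algebra_simps)
  also have "\<dots> = x" using pos by (simp add: q_def)
  finally show "measure_pmf.expectation (stoch_round R B x) (\<lambda>x. x) = x" .
qed

text \<open>Subtracting the constant \<open>A $$ (i, j)\<close> leaves a variance unchanged, and the
  marginal of the product law at \<open>(i, j)\<close> is the rounding of that single entry.\<close>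

lemma error_variance_eq:
  assumes A: "A \<in> carrier_mat n d" and i: "i < n" and j: "j < d"
    and fin: "finite (set_pmf (stoch_round R B (A $$ (i, j))))"
  shows "error_variance R B A i j = measure_pmf.variance (stoch_round R B (A $$ (i, j))) (\<lambda>x. x)"
proof -
  let ?P = "Pi_pmf ({..<n} \<times> {..<d}) 0 (\<lambda>ij. stoch_round R B (A $$ ij))"
  let ?p = "stoch_round R B (A $$ (i, j))"
  have S: "finite ({..<n} \<times> {..<d})" "(i, j) \<in> {..<n} \<times> {..<d}" using i j by auto
  have entry: "(Matrix.mat n d F - A) $$ (i, j) = F (i, j) - A $$ (i, j)" for F
    using A i j by simp
  have comp: "measure_pmf.expectation ?P (\<lambda>F. g (F (i, j))) = measure_pmf.expectation ?p g" for g :: "real \<Rightarrow> real"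
    by (rule Pi_pmf_expectation_component[OF S])
  have mean: "measure_pmf.expectation ?p (\<lambda>x. x - A $$ (i, j)) = measure_pmf.expectation ?p (\<lambda>x. x) - A $$ (i, j)"
    by (simp add: integrable_measure_pmf_finite[OF fin])
  have "error_variance R B A i j = measure_pmf.expectation ?P
      (\<lambda>F. (F (i, j) - A $$ (i, j) - measure_pmf.expectation ?P (\<lambda>F. F (i, j) - A $$ (i, j)))\<^sup>2)"
    using A unfolding error_variance_def stoch_round_mat_def by (simp add: entry)
  also have "\<dots> = measure_pmf.expectation ?p (\<lambda>x. (x - A $$ (i, j) - measure_pmf.expectation ?p (\<lambda>x. x - A $$ (i, j)))\<^sup>2)"
    using comp[of "\<lambda>x. (x - A $$ (i, j) - measure_pmf.expectation ?p (\<lambda>x. x - A $$ (i, j)))\<^sup>2"]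
      comp[of "\<lambda>x. x - A $$ (i, j)"] by simp
  finally show ?thesis unfolding mean by simp
qed

lemma column_variance_ge:
  assumes A: "A \<in> carrier_mat n d" and d: "d \<ge> 1" "n > d" and rho: "resolution R B > 0"
    and nu: "\<nu> \<le> normalized_min_col_variance R B A" and j: "j < d"
  shows "\<nu> * real n * (resolution R B)\<^sup>2 \<le> (\<Sum>i<n. error_variance R B A i j)"
proof -
  let ?M = "Min ((\<lambda>j. \<Sum>i<n. error_variance R B A i j) ` {..<d})"
  have "\<nu> \<le> 1 / (real n * (resolution R B)\<^sup>2) * ?M"
    using nu A by (simp add: normalized_min_col_variance_def)
  then have "\<nu> * (real n * (resolution R B)\<^sup>2) \<le> ?M"
    using d rho by (simp add: field_simps)
  also have "?M \<le> (\<Sum>i<n. error_variance R B A i j)" using j by (intro Min_le) auto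
  finally show ?thesis by (simp add: mult.assoc)
qed

section \<open>Choice of the constants and the union bound\<close>

text \<open>The order of the quantifiers expresses that \<open>c\<^sub>0\<close> depends on
  \<open>\<nu>\<^sub>0\<close> alone. In the proof the same holds for the aspect ratio bound
  \<open>\<eta>\<close>; the exponent \<open>a\<close> enters only through
  \<open>n\<^sub>0\<close>.\<close>

theorem mainTheorem2:
  shows "\<forall>\<nu>\<^sub>0::real. \<nu>\<^sub>0 > 0 \<longrightarrow> (\<exists>c\<^sub>0::real. c\<^sub>0 > 0 \<and>
    (\<forall>a::real. a > 0 \<longrightarrow> (\<exists>(\<eta>\<^sub>0::real) (n\<^sub>0::nat). \<eta>\<^sub>0 > 0 \<and>
      (\<forall>(n::nat) (d::nat) (A::real mat) (R::real) (B::nat).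
         d \<ge> 1 \<and> n > d \<and> A \<in> carrier_mat n d \<and> R > 0 \<and> B \<ge> 1 \<and>
         (\<forall>i<n. \<forall>j<d. \<bar>A $$ (i, j)\<bar> \<le> R) \<and>
         normalized_min_col_variance R B A \<ge> \<nu>\<^sub>0 \<and> real d \<le> \<eta>\<^sub>0 * real n \<and> n \<ge> n\<^sub>0
         \<longrightarrow> measure_pmf.prob (stoch_round_mat R B A)
               {X. singular_value d X \<ge> c\<^sub>0 * resolution R B * sqrt (real n)}
             \<ge> 1 - 3 * real n powr (- a)))))"
proof (intro allI impI)
  fix \<nu> :: real
  assume nu: "\<nu> > 0"
  obtain C where C: "C > 0"
    and op_tail: "\<And>n d \<rho> l (p :: nat \<times> nat \<Rightarrow> real pmf). \<lbrakk>d \<le> n; \<rho> > 0;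
      \<And>k. k \<in> {..<n} \<times> {..<d} \<Longrightarrow> finite (set_pmf (p k));
      \<And>k. k \<in> {..<n} \<times> {..<d} \<Longrightarrow> set_pmf (p k) \<subseteq> {l k..l k + \<rho>}\<rbrakk> \<Longrightarrow>
      measure_pmf.prob (Pi_pmf ({..<n} \<times> {..<d}) 0 p)
        {X. \<exists>x. L2_set x {..<d} \<le> 1 \<and> C * \<rho> * sqrt (real n) <
          L2_set (\<lambda>i. \<Sum>j<d. x j * (X (i, j) - measure_pmf.expectation (p (i, j)) (\<lambda>x. x))) {..<n}}
      \<le> exp (- real n)"
    by (fact operator_norm_tail)
  \<comment> \<open>\<open>b\<close> is the radius of the small ball estimate in units of
    \<open>\<rho> * sqrt n\<close>. A quarter of it is left for \<open>c\<close> and three quarters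
    for the net error \<open>3 * C * \<epsilon>\<close>.\<close>
  define b where "b = sqrt (\<nu> / 32)"
  define c where "c = min C (b / 4)"
  define \<epsilon> where "\<epsilon> = min (1 / 2) (b / (4 * C))"
  define \<kappa> where "\<kappa> = \<nu>\<^sup>2 / 24576"
  have b: "b > 0" "b\<^sup>2 = \<nu> / 32" using nu by (auto simp: b_def)
  have kappa: "\<kappa> > 0" using nu by (simp add: \<kappa>_def)
  have c: "c > 0" "c \<le> C" using b C by (auto simp: c_def)
  have eps: "0 < \<epsilon>" "\<epsilon> \<le> 1 / 2" using b C by (auto simp: \<epsilon>_def)
  have "C * \<epsilon> \<le> C * (b / (4 * C))" using C by (intro mult_left_mono) (auto simp: \<epsilon>_def)
  then have "C * \<epsilon> \<le> b / 4" using C by simp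
  then have cb: "c + 3 * C * \<epsilon> \<le> b" by (simp add: c_def)
  obtain K where K: "K \<ge> 1" and net: "\<And>d. \<exists>N :: (nat \<Rightarrow> real) set. finite N \<and> real (card N) \<le> K ^ d \<and>
    (\<forall>y\<in>N. L2_set y {..<d} \<le> 1) \<and>
    (\<forall>x. L2_set x {..<d} \<le> 1 \<longrightarrow> (\<exists>y\<in>N. L2_set (\<lambda>i. x i - y i) {..<d} \<le> \<epsilon>))"
    using ball_net[OF eps(1)] by auto
  have lnK: "ln K \<ge> 0" using K by simp
  \<comment> \<open>Chosen so that the \<open>K ^ (2 * d)\<close> pairs of net points use up at most
    half of the rate \<open>\<kappa>\<close>. Adding 1 to \<open>ln K\<close> avoids a division by
    0.\<close>
  define \<eta> where "\<eta> = \<kappa> / (4 * (1 + ln K))"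
  have eta: "\<eta> > 0" using kappa lnK by (simp add: \<eta>_def)
  show "\<exists>c\<^sub>0::real. c\<^sub>0 > 0 \<and>
    (\<forall>a::real. a > 0 \<longrightarrow> (\<exists>(\<eta>\<^sub>0::real) (n\<^sub>0::nat). \<eta>\<^sub>0 > 0 \<and>
      (\<forall>(n::nat) (d::nat) (A::real mat) (R::real) (B::nat).
         d \<ge> 1 \<and> n > d \<and> A \<in> carrier_mat n d \<and> R > 0 \<and> B \<ge> 1 \<and>
         (\<forall>i<n. \<forall>j<d. \<bar>A $$ (i, j)\<bar> \<le> R) \<and>
         normalized_min_col_variance R B A \<ge> \<nu> \<and> real d \<le> \<eta>\<^sub>0 * real n \<and> n \<ge> n\<^sub>0
         \<longrightarrow> measure_pmf.prob (stoch_round_mat R B A)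
               {X. singular_value d X \<ge> c\<^sub>0 * resolution R B * sqrt (real n)}
             \<ge> 1 - 3 * real n powr (- a))))"
  proof (rule exI[of _ c], intro conjI allI impI c)
    fix a :: real
    assume a: "a > 0"
    have "eventually (\<lambda>n::nat. exp (- real n) \<le> real n powr (- a)) sequentially"
      using a by real_asymp
    moreover have "eventually (\<lambda>n::nat. exp (- (\<kappa> / 2) * real n) \<le> real n powr (- a)) sequentially"
      using a kappa by real_asymp
    ultimately have "eventually (\<lambda>n::nat. exp (- real n) \<le> real n powr (- a) \<and>
        exp (- (\<kappa> / 2) * real n) \<le> real n powr (- a)) sequentially"
      by (rule eventually_conj)
    then obtain n\<^sub>0 where n0: "\<And>n. n \<ge> n\<^sub>0 \<Longrightarrow> exp (- real n) \<le> real n powr (- a)"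
      "\<And>n. n \<ge> n\<^sub>0 \<Longrightarrow> exp (- (\<kappa> / 2) * real n) \<le> real n powr (- a)"
      unfolding eventually_sequentially by blast
    show "\<exists>(\<eta>\<^sub>0::real) (n\<^sub>0::nat). \<eta>\<^sub>0 > 0 \<and>
      (\<forall>(n::nat) (d::nat) (A::real mat) (R::real) (B::nat).
         d \<ge> 1 \<and> n > d \<and> A \<in> carrier_mat n d \<and> R > 0 \<and> B \<ge> 1 \<and>
         (\<forall>i<n. \<forall>j<d. \<bar>A $$ (i, j)\<bar> \<le> R) \<and>
         normalized_min_col_variance R B A \<ge> \<nu> \<and> real d \<le> \<eta>\<^sub>0 * real n \<and> n \<ge> n\<^sub>0
         \<longrightarrow> measure_pmf.prob (stoch_round_mat R B A)
               {X. singular_value d X \<ge> c * resolution R B * sqrt (real n)}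
             \<ge> 1 - 3 * real n powr (- a))"
    proof (rule exI[of _ \<eta>], rule exI[of _ n\<^sub>0], intro conjI allI impI eta)
      fix n d :: nat and A :: "real mat" and R :: real and B :: nat
      assume "d \<ge> 1 \<and> n > d \<and> A \<in> carrier_mat n d \<and> R > 0 \<and> B \<ge> 1 \<and>
         (\<forall>i<n. \<forall>j<d. \<bar>A $$ (i, j)\<bar> \<le> R) \<and>
         normalized_min_col_variance R B A \<ge> \<nu> \<and> real d \<le> \<eta> * real n \<and> n \<ge> n\<^sub>0"
      then have d: "d \<ge> 1" "n > d" and A: "A \<in> carrier_mat n d" and R: "R > 0" and B: "B \<ge> 1"
        and AR: "\<forall>i<n. \<forall>j<d. \<bar>A $$ (i, j)\<bar> \<le> R"
        and var: "normalized_min_col_variance R B A \<ge> \<nu>" and dn: "real d \<le> \<eta> * real n" and n: "n \<ge> n\<^sub>0"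
        by blast+
      define \<rho> where "\<rho> = resolution R B"
      have rho: "\<rho> > 0" unfolding \<rho>_def using R B by (rule resolution_pos)
      define s where "s = \<rho> * sqrt (real n)"
      have s: "s > 0" using rho d by (simp add: s_def)
      let ?S = "{..<n} \<times> {..<d}"
      define p where "p k = stoch_round R B (A $$ k)" for k
      let ?P = "Pi_pmf ?S 0 p"
      have AR': "\<bar>A $$ k\<bar> \<le> R" if "k \<in> ?S" for k using AR that by auto
      note sr = stoch_round_support_mean[OF R B AR', folded p_def \<rho>_def]
      obtain l where l: "\<And>k. k \<in> ?S \<Longrightarrow> set_pmf (p k) \<subseteq> {l k..l k + \<rho>}"
        using sr(2) by metis
      have mean: "measure_pmf.expectation (p (i, j)) (\<lambda>x. x) = A $$ (i, j)" if "i < n" "j < d" for i j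
        using sr(3)[of "(i, j)"] that by simp
      have col: "\<nu> * real n * \<rho>\<^sup>2 \<le> (\<Sum>i<n. measure_pmf.variance (p (i, j)) (\<lambda>x. x))" if j: "j < d" for j
      proof -
        have "error_variance R B A i j = measure_pmf.variance (p (i, j)) (\<lambda>x. x)" if "i < n" for i
          unfolding p_def using sr(1)[of "(i, j)"] that j by (intro error_variance_eq[OF A]) (auto simp: p_def)
        then show ?thesis
          using column_variance_ge[OF A d _ var j] rho by (simp add: \<rho>_def)
      qed
      obtain N where N: "finite N" "real (card N) \<le> K ^ d" "\<And>y. y \<in> N \<Longrightarrow> L2_set y {..<d} \<le> 1"
        "\<And>x. L2_set x {..<d} \<le> 1 \<Longrightarrow> \<exists>y\<in>N. L2_set (\<lambda>j. x j - y j) {..<d} \<le> \<epsilon>"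
        using net[of d] by blast
      obtain u where u: "\<And>c. L2_set (\<lambda>i. \<Sum>k<d. c k * u k i) {..<n} \<le> L2_set c {..<d}"
        "\<And>x. \<exists>c. L2_set c {..<d} = L2_set (\<lambda>i. \<Sum>j<d. x j * A $$ (i, j)) {..<n} \<and>
           (\<forall>i<n. (\<Sum>j<d. x j * A $$ (i, j)) = (\<Sum>k<d. c k * u k i))"
        using ex_range_coordinates[of d n "\<lambda>j i. A $$ (i, j)"] by blast
      \<comment> \<open>The shift is deterministic, as the small ball estimate for fixed
        \<open>x\<close> requires.\<close>
      define y where "y x z i = (\<Sum>j<d. x j * A $$ (i, j)) - 2 * C * s * (\<Sum>k<d. z k * u k i)" for x z i
      define Bad1 where "Bad1 = {X. \<exists>x. L2_set x {..<d} \<le> 1 \<and> C * \<rho> * sqrt (real n) <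
        L2_set (\<lambda>i. \<Sum>j<d. x j * (X (i, j) - measure_pmf.expectation (p (i, j)) (\<lambda>x. x))) {..<n}}"
      define Bad2 where "Bad2 = (\<lambda>(x, z). {X. (\<Sum>i<n. ((\<Sum>j<d. x j * X (i, j)) - y x z i)\<^sup>2)
        \<le> \<nu> / 32 * real n * \<rho>\<^sup>2})"
      define M where "M = {x \<in> N. 1 / 2 \<le> L2_set x {..<d}} \<times> N"
      have finM: "finite M" using N(1) by (simp add: M_def)
      have cardM: "real (card M) \<le> K ^ d * K ^ d"
      proof -
        have "real (card {x \<in> N. 1 / 2 \<le> L2_set x {..<d}}) \<le> real (card N)"
          using N(1) by (intro of_nat_mono card_mono) auto
        then have "real (card {x \<in> N. 1 / 2 \<le> L2_set x {..<d}}) * real (card N) \<le> K ^ d * K ^ d"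
          using N(2) K by (intro mult_mono) auto
        then show ?thesis by (simp add: M_def card_cartesian_product)
      qed
      have P1: "measure_pmf.prob ?P Bad1 \<le> exp (- real n)"
        unfolding Bad1_def using d rho sr(1) l by (intro op_tail[where l = l]) auto
      have P2: "measure_pmf.prob ?P (Bad2 w) \<le> exp (- \<kappa> * real n)" if w: "w \<in> M" for w
      proof -
        obtain x z where xz: "w = (x, z)" "x \<in> N" "1 / 2 \<le> L2_set x {..<d}" using w by (auto simp: M_def)
        have "(1 / 2)\<^sup>2 \<le> (L2_set x {..<d})\<^sup>2" "(L2_set x {..<d})\<^sup>2 \<le> 1\<^sup>2"
          using xz N(3)[OF xz(2)] by (intro power_mono; simp)+
        then have "1 / 4 \<le> (\<Sum>j<d. (x j)\<^sup>2)" "(\<Sum>j<d. (x j)\<^sup>2) \<le> 1"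
          unfolding L2_set_power2 by (simp_all add: power2_eq_square)
        then show ?thesis
          unfolding Bad2_def xz(1) prod.case \<kappa>_def
          using rho nu sr(1) l col by (intro small_ball_fixed_vector[where l = l]) auto
      qed
      \<comment> \<open>Outside the bad events everything is deterministic: the complement of
        \<open>Bad1\<close> bounds the operator norm of the error, the complement of all
        \<open>Bad2\<close> events gives the lower bound on the nets.\<close>
      have good: "singular_value d (Matrix.mat n d X) \<ge> c * s"
        if X: "X \<notin> Bad1 \<union> (\<Union>w\<in>M. Bad2 w)" for X
      proof (rule singular_value_min_ge)
        show "Matrix.mat n d X \<in> carrier_mat n d" "d \<ge> 1" "c * s \<ge> 0" using d c s by auto
        fix v :: "nat \<Rightarrow> real"
        assume v: "(\<Sum>j<d. (v j)\<^sup>2) = 1"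
        have "c * s \<le> L2_set (\<lambda>i. \<Sum>j<d. v j * X (i, j)) {..<n}"
        proof (rule L2_set_lower_bound_by_nets[OF s C c(2) cb eps _ N(4) u])
          fix x :: "nat \<Rightarrow> real" assume x: "L2_set x {..<d} \<le> 1"
          have "L2_set (\<lambda>i. \<Sum>j<d. x j * (X (i, j) - A $$ (i, j))) {..<n}
            = L2_set (\<lambda>i. \<Sum>j<d. x j * (X (i, j) - measure_pmf.expectation (p (i, j)) (\<lambda>x. x))) {..<n}"
            by (intro L2_set_cong refl sum.cong) (simp add: mean)
          then show "L2_set (\<lambda>i. \<Sum>j<d. x j * (X (i, j) - A $$ (i, j))) {..<n} \<le> C * s"
            using X x unfolding Bad1_def s_def by (auto simp: not_less mult.assoc)
        next
          fix x z assume xz: "x \<in> N" "z \<in> N" "1 / 2 \<le> L2_set x {..<d}"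
          then have "X \<notin> Bad2 (x, z)" using X by (auto simp: M_def)
          then have "\<nu> / 32 * real n * \<rho>\<^sup>2 < (L2_set (\<lambda>i. (\<Sum>j<d. x j * X (i, j)) - y x z i) {..<n})\<^sup>2"
            unfolding L2_set_power2 Bad2_def by simp
          also have "\<nu> / 32 * real n * \<rho>\<^sup>2 = (b * s)\<^sup>2"
            by (simp add: power_mult_distrib b s_def)
          finally show "b * s < L2_set (\<lambda>i. (\<Sum>j<d. x j * X (i, j)) -
              ((\<Sum>j<d. x j * A $$ (i, j)) - 2 * C * s * (\<Sum>k<d. z k * u k i))) {..<n}"
            unfolding y_def by (rule power2_less_imp_less) simp
        next
          show "L2_set v {..<d} = 1" using v by (simp add: L2_set_def)
        qed
        then have "(c * s)\<^sup>2 \<le> (L2_set (\<lambda>i. \<Sum>j<d. v j * X (i, j)) {..<n})\<^sup>2"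
          using c s by (intro power_mono) auto
        then show "(c * s)\<^sup>2 \<le> (\<Sum>i<n. (\<Sum>j<d. v j * Matrix.mat n d X $$ (i, j))\<^sup>2)"
          unfolding L2_set_power2 by simp
      qed
      have "1 - measure_pmf.prob ?P (Bad1 \<union> (\<Union>w\<in>M. Bad2 w))
          = measure_pmf.prob ?P (- (Bad1 \<union> (\<Union>w\<in>M. Bad2 w)))"
        by (subst measure_pmf.prob_compl[symmetric]) (auto simp: Compl_eq_Diff_UNIV)
      also have "\<dots> \<le> measure_pmf.prob ?P (Matrix.mat n d -` {X. singular_value d X \<ge> c * s})"
        using good by (intro measure_pmf.finite_measure_mono) auto
      also have "\<dots> = measure_pmf.prob (stoch_round_mat R B A)
               {X. singular_value d X \<ge> c * resolution R B * sqrt (real n)}"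
        using A by (simp add: stoch_round_mat_def p_def[abs_def] s_def \<rho>_def mult.assoc)
      finally have main: "1 - measure_pmf.prob ?P (Bad1 \<union> (\<Union>w\<in>M. Bad2 w))
          \<le> measure_pmf.prob (stoch_round_mat R B A)
               {X. singular_value d X \<ge> c * resolution R B * sqrt (real n)}" .
      have "measure_pmf.prob ?P (\<Union>w\<in>M. Bad2 w) \<le> (\<Sum>w\<in>M. measure_pmf.prob ?P (Bad2 w))"
        using finM by (intro measure_pmf.finite_measure_subadditive_finite) auto
      also have "\<dots> \<le> real (card M) * exp (- \<kappa> * real n)"
        by (intro sum_bounded_above P2)
      also have "\<dots> \<le> K ^ d * K ^ d * exp (- \<kappa> * real n)"
        by (intro mult_right_mono cardM) simp
      also have "K ^ d = exp (real d * ln K)" using K by (simp add: exp_of_nat_mult)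
      also have "exp (real d * ln K) * exp (real d * ln K) * exp (- \<kappa> * real n)
          = exp (2 * (real d * ln K) - \<kappa> * real n)"
        by (simp add: exp_add[symmetric])
      also have "\<dots> \<le> exp (- (\<kappa> / 2) * real n)"
      proof -
        have "real d * ln K \<le> \<eta> * real n * (1 + ln K)"
          using dn lnK eta by (intro mult_mono) auto
        also have "\<dots> = \<kappa> / 4 * real n" using lnK by (simp add: \<eta>_def field_simps)
        finally show ?thesis by simp
      qed
      finally have P2': "measure_pmf.prob ?P (\<Union>w\<in>M. Bad2 w) \<le> exp (- (\<kappa> / 2) * real n)" .
      have "measure_pmf.prob ?P (Bad1 \<union> (\<Union>w\<in>M. Bad2 w))
          \<le> measure_pmf.prob ?P Bad1 + measure_pmf.prob ?P (\<Union>w\<in>M. Bad2 w)"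
        by (rule measure_Un_le) auto
      \<comment> \<open>For \<open>n \<ge> n\<^sub>0\<close> each of the two exponentially small
        bounds is at most one copy of \<open>n powr (- a)\<close>.\<close>
      also have "\<dots> \<le> real n powr (- a) + real n powr (- a)"
        using P1 P2' n0[OF n] by linarith
      also have "\<dots> \<le> 3 * real n powr (- a)" by simp
      finally show "1 - 3 * real n powr (- a) \<le> measure_pmf.prob (stoch_round_mat R B A)
               {X. singular_value d X \<ge> c * resolution R B * sqrt (real n)}"
        using main by linarith
    qed
  qed
qed

end
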